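(* Let $a,m\ge1$ be integers with $m$ odd (and $m\le n$). Then $$R_{(a\,1^{m-1})}=(R_{(1)}-1)(R_{(1)}-2)\cdots(R_{(1)}-a+1)\,R_{(1^m)} .$$
   Context: Let $k$ be a field of characteristic zero, $n\ge 1$, $\mathcal P=k[z_1,\dots,z_n]$, and let $W\subseteq S_n$ be the group of permutations $\pi$ with $\pi(i)\equiv i \bmod 2$ for all $i$, acting by permuting variables. $\Lambda$ is the set of integer tuples $\lambda=(\lambda_1\ge\dots\ge\lambda_n\ge 0)$ and $|\lambda|_{\rm odd}=\sum_{i\text{ odd}}\lambda_i$. Fix $r\in k$ which is not a negative rational number and put $\rho=((n-1)r,(n-2)r,\dots,r,0)$. For $\lambda\in\Lambda$ let $[\lambda]_m=\lambda_m-\lambda_{m+1}+\dots+(-1)^{n-m}\lambda_n$. $R_\lambda=R_\lambda(z;r)\in\mathcal P^W$ is the unique $W$-invariant polynomial of degree $|\lambda|_{\rm odd}$ which satisfies $R_\lambda(\rho+\mu)=0$ for all $\mu\in\Lambda$ with $|\mu|_{\rm odd}\le|\lambda|_{\rm odd}$, $\mu\ne\lambda$, and in which the monomial $z^{[\lambda]}$ has coefficient $1$ (it is known that this exists and is unique). $(a\,1^{m-1})\in\Lambda$ is the partition $(a,1,\dots,1,0,\dots,0)$ with $m-1$ ones; $(1^m)$ has $m$ ones; $(1)=(1,0,\dots,0)$. For $a=1$ the product preceding $R_{(1^m)}$ is empty, i.e. equal to $1$. *)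

theory Defs
  imports
    Complex_Main
    "HOL-Library.Poly_Mapping"
    "HOL-Combinatorics.Permutations"
begin

text \<open>
  A polynomial is a finitely supported map from monomials to coefficients, a monomial a finitely
  supported map from indices to exponents; multiplication is the convolution product of
  \<^theory>\<open>HOL-Library.Poly_Mapping\<close>. The variable \<open>z\<^sub>i\<close> has index \<open>i\<close> (starting at 1), and the
  polynomial ring in \<open>z\<^sub>1, \<dots>, z\<^sub>n\<close> is the subring \<open>poly_ring n\<close>.
\<close>

type_synonym monomial = "nat \<Rightarrow>\<^sub>0 nat"
type_synonym 'k polynomial = "monomial \<Rightarrow>\<^sub>0 'k"

definition poly_ring :: "nat \<Rightarrow> 'k::comm_ring_1 polynomial set" where
  "poly_ring n = {p. \<forall>e \<in> Poly_Mapping.keys p. Poly_Mapping.keys e \<subseteq> {1..n}}"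

definition eval_poly :: "(nat \<Rightarrow> 'k) \<Rightarrow> 'k::comm_ring_1 polynomial \<Rightarrow> 'k" where
  "eval_poly z p = (\<Sum>e \<in> Poly_Mapping.keys p. Poly_Mapping.lookup p e *
     (\<Prod>i \<in> Poly_Mapping.keys e. z i ^ Poly_Mapping.lookup e i))"

definition monomial_degree :: "monomial \<Rightarrow> nat" where
  "monomial_degree e = (\<Sum>i \<in> Poly_Mapping.keys e. Poly_Mapping.lookup e i)"

definition total_degree :: "'k::comm_ring_1 polynomial \<Rightarrow> nat" where
  "total_degree p = Max (insert 0 (monomial_degree ` Poly_Mapping.keys p))"

definition W :: "nat \<Rightarrow> (nat \<Rightarrow> nat) set" where
  "W n = {\<pi>. \<pi> permutes {1..n} \<and> (\<forall>i \<in> {1..n}. \<pi> i mod 2 = i mod 2)}"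

text \<open>
  For a permutation \<open>\<pi>\<close>, the coefficient of a monomial \<open>e\<close> in \<open>permute_vars \<pi> p\<close> is the coefficient
  of \<open>e \<circ> \<pi>\<close> in \<open>p\<close>, so \<open>permute_vars \<pi>\<close> replaces each variable \<open>z\<^sub>i\<close> by \<open>z\<close> with index \<open>\<pi> i\<close>.
  (The function \<open>Poly_Mapping.map_key\<close> is specified for injective arguments only.)
\<close>
definition permute_vars ::
    "(nat \<Rightarrow> nat) \<Rightarrow> 'k::comm_ring_1 polynomial \<Rightarrow> 'k polynomial" where
  "permute_vars \<pi> p = Poly_Mapping.map_key (Poly_Mapping.map_key \<pi>) p"

lemma lookup_permute_vars:
  assumes "\<pi> permutes S"
  shows "Poly_Mapping.lookup (permute_vars \<pi> p) e =
    Poly_Mapping.lookup p (Poly_Mapping.map_key \<pi> e)"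
proof -
  have inj: "inj \<pi>" and surj: "surj \<pi>"
    using assms by (simp_all add: permutes_inj permutes_surj)
  have "inj (Poly_Mapping.map_key \<pi> :: monomial \<Rightarrow> monomial)"
  proof (rule injI)
    fix e e' :: monomial
    assume "Poly_Mapping.map_key \<pi> e = Poly_Mapping.map_key \<pi> e'"
    then have "Poly_Mapping.lookup e (\<pi> i) = Poly_Mapping.lookup e' (\<pi> i)" for i
      using inj by (metis map_key.rep_eq comp_apply)
    then have "Poly_Mapping.lookup e j = Poly_Mapping.lookup e' j" for j
      using surj by (metis surjD)
    then show "e = e'" by (simp add: poly_mapping_eqI)
  qed
  then show ?thesis
    by (simp add: permute_vars_def map_key.rep_eq)
qed

text \<open>
  Tuples \<open>(\<lambda>\<^sub>1, \<dots>, \<lambda>\<^sub>n)\<close> are functions on indices, extended by 0 outside \<open>{1..n}\<close> so that distinct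
  functions in \<open>\<Lambda> n\<close> are distinct tuples.
\<close>
definition \<Lambda> :: "nat \<Rightarrow> (nat \<Rightarrow> nat) set" where
  "\<Lambda> n = {l. (\<forall>i. i \<notin> {1..n} \<longrightarrow> l i = 0) \<and> (\<forall>i \<in> {1..<n}. l (Suc i) \<le> l i)}"

definition odd_size :: "nat \<Rightarrow> (nat \<Rightarrow> nat) \<Rightarrow> nat" where
  "odd_size n l = (\<Sum>i \<in> {i \<in> {1..n}. odd i}. l i)"

definition bracket :: "nat \<Rightarrow> (nat \<Rightarrow> nat) \<Rightarrow> nat \<Rightarrow> int" where
  "bracket n l m = (\<Sum>j = m..n. (- 1) ^ (j - m) * int (l j))"

text \<open>
  The monomial \<open>z\<close> to the power \<open>[l]\<close>; the truncation \<open>nat\<close> is harmless because \<open>bracket n l m \<ge> 0\<close>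
  for \<open>l \<in> \<Lambda> n\<close>.
\<close>
definition bracket_monomial :: "nat \<Rightarrow> (nat \<Rightarrow> nat) \<Rightarrow> monomial" where
  "bracket_monomial n l = (\<Sum>m = 1..n. Poly_Mapping.single m (nat (bracket n l m)))"

definition \<rho> :: "nat \<Rightarrow> 'k::comm_ring_1 \<Rightarrow> nat \<Rightarrow> 'k" where
  "\<rho> n r i = of_nat (n - i) * r"

definition is_R :: "nat \<Rightarrow> 'k::field_char_0 \<Rightarrow> (nat \<Rightarrow> nat) \<Rightarrow> 'k polynomial \<Rightarrow> bool" where
  "is_R n r l p \<longleftrightarrow>
     p \<in> poly_ring n \<and>
     (\<forall>\<pi> \<in> W n. permute_vars \<pi> p = p) \<and>
     total_degree p = odd_size n l \<and>
     (\<forall>\<mu> \<in> \<Lambda> n. odd_size n \<mu> \<le> odd_size n l \<and> \<mu> \<noteq> l \<longrightarrow>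
        eval_poly (\<lambda>i. \<rho> n r i + of_nat (\<mu> i)) p = 0) \<and>
     Poly_Mapping.lookup p (bracket_monomial n l) = 1"

text \<open>
  Existence and uniqueness hold for \<open>l \<in> \<Lambda> n\<close> if \<open>r\<close> is not a negative rational number; otherwise
  the value may be arbitrary.
\<close>
definition R :: "nat \<Rightarrow> 'k::field_char_0 \<Rightarrow> (nat \<Rightarrow> nat) \<Rightarrow> 'k polynomial" where
  "R n r l = (THE p. is_R n r l p)"

text \<open>The partition \<open>(a, 1, \<dots>, 1, 0, \<dots>, 0)\<close> with \<open>m - 1\<close> ones, for \<open>m \<ge> 1\<close>.\<close>
definition hook :: "nat \<Rightarrow> nat \<Rightarrow> nat \<Rightarrow> nat" where
  "hook a m = (\<lambda>i. if i = 1 then a else if i \<in> {2..m} then 1 else 0)"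

text \<open>The partition \<open>(1, \<dots>, 1, 0, \<dots>, 0)\<close> with \<open>m\<close> ones.\<close>
definition column :: "nat \<Rightarrow> nat \<Rightarrow> nat" where
  "column m = (\<lambda>i. if i \<in> {1..m} then 1 else 0)"

end

theory Submission
  imports Defs "HOL-Computational_Algebra.Polynomial"
begin

text \<open>
  Write \<open>\<delta>(\<mu>) = \<mu>\<^sub>1 - \<mu>\<^sub>2 + \<mu>\<^sub>3 - \<dots>\<close>. The proof shows that the right-hand side satisfies the conditions
  that define the left-hand side, so it needs that these conditions have at most one solution, and it
  needs to know the polynomials of columns of odd length well enough.

  Uniqueness rests on \<open>semisymmetric_vanishing\<close>: an invariant polynomial of degree at most \<open>d\<close> which
  vanishes at \<open>\<rho> + \<mu>\<close> for all \<open>\<mu>\<close> with \<open>odd_size n \<mu> \<le> d\<close> is zero, provided that \<open>r\<close> is not a negative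
  rational number. It is proved by restricting to a hyperplane and dividing by linear forms;
  \<open>is_R_unique\<close> draws the conclusion.

  The polynomials of odd columns are given explicitly by \<open>column_poly\<close>. Put
  \<open>A(t) = \<Prod>(t - z\<^sub>i)\<close> over odd \<open>i\<close> and \<open>B(t) = \<Prod>(t - r - z\<^sub>i)\<close> over even \<open>i\<close>, with an additional factor \<open>t\<close>
  if \<open>n\<close> is odd. At \<open>z = \<rho> + \<mu>\<close> these are the products of \<open>t - \<rho>\<^sub>i - \<mu>\<^sub>i\<close> and of \<open>t - \<rho>\<^sub>i - \<mu>\<^sub>i\<^sub>+\<^sub>1\<close>
  over odd \<open>i\<close>. The divided difference of \<open>A - B\<close> at the nodes \<open>\<rho>\<^sub>i\<close>, \<open>i \<ge> m\<close> odd, is up to sign an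
  invariant polynomial of degree \<open>(m + 1) / 2\<close> with the right coefficient. It vanishes if
  \<open>\<mu>\<^sub>m = 0\<close>, because then \<open>A\<close> and \<open>B\<close> are divisible by the product of the \<open>t - \<rho>\<^sub>i\<close>, and if
  \<open>\<delta>(\<mu>) = 0\<close>, because then \<open>A = B\<close> (\<open>column_poly_vanishing\<close>). For \<open>m = 1\<close> its value at
  \<open>\<rho> + \<mu>\<close> is \<open>\<delta>(\<mu>)\<close>.

  So the product in the theorem vanishes at \<open>\<rho> + \<mu>\<close> unless \<open>\<mu>\<^sub>m \<ge> 1\<close> and \<open>\<delta>(\<mu>) \<ge> a\<close>. By a count
  of the entries (\<open>hook_characterization\<close>), the only such \<open>\<mu>\<close> in the relevant range is the hook
  itself. The case \<open>a = 1\<close> of this argument identifies \<open>column_poly\<close> with the polynomial of the column.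
\<close>

section \<open>Polynomials and the functions they define\<close>

definition monomial_value :: "(nat \<Rightarrow> 'k) \<Rightarrow> monomial \<Rightarrow> 'k::comm_ring_1" where
  "monomial_value z e = (\<Prod>i \<in> Poly_Mapping.keys e. z i ^ Poly_Mapping.lookup e i)"

lemma monomial_value_superset:
  assumes "finite J" "Poly_Mapping.keys e \<subseteq> J"
  shows "monomial_value z e = (\<Prod>i \<in> J. z i ^ Poly_Mapping.lookup e i)"
  unfolding monomial_value_def
  by (rule prod.mono_neutral_left) (use assms in \<open>auto simp: in_keys_iff\<close>)

lemma monomial_value_add: "monomial_value z (e + e') = monomial_value z e * monomial_value z e'"
proof -
  let ?J = "Poly_Mapping.keys e \<union> Poly_Mapping.keys e'"
  have "monomial_value z (e + e') = (\<Prod>i \<in> ?J. z i ^ Poly_Mapping.lookup (e + e') i)"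
    by (rule monomial_value_superset) (use keys_add[of e e'] in auto)
  also have "\<dots> = (\<Prod>i \<in> ?J. z i ^ Poly_Mapping.lookup e i) * (\<Prod>i \<in> ?J. z i ^ Poly_Mapping.lookup e' i)"
    by (simp add: lookup_add power_add prod.distrib)
  also have "\<dots> = monomial_value z e * monomial_value z e'"
    using monomial_value_superset[of ?J e z] monomial_value_superset[of ?J e' z] by simp
  finally show ?thesis .
qed

lemma eval_poly_superset:
  assumes "finite K" "Poly_Mapping.keys p \<subseteq> K"
  shows "eval_poly z p = (\<Sum>e \<in> K. Poly_Mapping.lookup p e * monomial_value z e)"
  unfolding eval_poly_def monomial_value_def
  by (rule sum.mono_neutral_left) (use assms in \<open>auto simp: in_keys_iff\<close>)

lemma eval_poly_add: "eval_poly z (p + q) = eval_poly z p + eval_poly z q"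
proof -
  let ?K = "Poly_Mapping.keys p \<union> Poly_Mapping.keys q"
  have "eval_poly z (p + q) = (\<Sum>e \<in> ?K. Poly_Mapping.lookup (p + q) e * monomial_value z e)"
    by (rule eval_poly_superset) (use keys_add[of p q] in auto)
  also have "\<dots> = eval_poly z p + eval_poly z q"
    using eval_poly_superset[of ?K p z] eval_poly_superset[of ?K q z]
    by (simp add: lookup_add distrib_right sum.distrib)
  finally show ?thesis .
qed

lemma eval_poly_zero [simp]: "eval_poly z 0 = 0"
  by (simp add: eval_poly_def)

lemma eval_poly_single: "eval_poly z (Poly_Mapping.single e c) = c * monomial_value z e"
  by (cases "c = 0") (simp_all add: eval_poly_def monomial_value_def)

lemma eval_poly_sum: "eval_poly z (\<Sum>i \<in> I. f i) = (\<Sum>i \<in> I. eval_poly z (f i))"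
  by (induction I rule: infinite_finite_induct) (simp_all add: eval_poly_add)

lemma poly_mapping_sum_singles:
  "(\<Sum>e \<in> Poly_Mapping.keys p. Poly_Mapping.single e (Poly_Mapping.lookup p e)) = p"
proof (rule poly_mapping_eqI)
  fix e
  show "Poly_Mapping.lookup (\<Sum>e \<in> Poly_Mapping.keys p. Poly_Mapping.single e (Poly_Mapping.lookup p e)) e
      = Poly_Mapping.lookup p e"
    by (simp add: lookup_sum lookup_single when_def in_keys_iff)
qed

lemma mult_eq_sum_singles:
  fixes p q :: "('a::monoid_add \<Rightarrow>\<^sub>0 'b::semiring_0)"
  shows "p * q = (\<Sum>e \<in> Poly_Mapping.keys p. \<Sum>e' \<in> Poly_Mapping.keys q.
    Poly_Mapping.single (e + e') (Poly_Mapping.lookup p e * Poly_Mapping.lookup q e'))"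
proof -
  let ?s = "\<lambda>p e. Poly_Mapping.single e (Poly_Mapping.lookup p e)"
  have "p * q = (\<Sum>e \<in> Poly_Mapping.keys p. ?s p e) * (\<Sum>e' \<in> Poly_Mapping.keys q. ?s q e')"
    by (simp only: poly_mapping_sum_singles)
  then show ?thesis by (simp add: sum_product mult_single)
qed

lemma eval_poly_mult: "eval_poly z (p * q) = eval_poly z p * eval_poly z q"
proof -
  have "eval_poly z (p * q) = (\<Sum>e \<in> Poly_Mapping.keys p. \<Sum>e' \<in> Poly_Mapping.keys q.
      (Poly_Mapping.lookup p e * monomial_value z e) * (Poly_Mapping.lookup q e' * monomial_value z e'))"
    by (subst mult_eq_sum_singles) (simp add: eval_poly_sum eval_poly_single monomial_value_add mult_ac)
  also have "\<dots> = eval_poly z p * eval_poly z q"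
    by (simp add: sum_product eval_poly_def monomial_value_def)
  finally show ?thesis .
qed

lemma eval_poly_diff: "eval_poly z (p - q) = eval_poly z p - eval_poly z q"
  using eval_poly_add[of z "p - q" q] by simp

lemma eval_poly_one [simp]: "eval_poly z 1 = 1"
  by (simp add: eval_poly_def)

lemma eval_poly_of_nat [simp]: "eval_poly z (of_nat j) = of_nat j"
  by (induction j) (simp_all add: eval_poly_add)

lemma eval_poly_prod: "eval_poly z (\<Prod>i \<in> I. f i) = (\<Prod>i \<in> I. eval_poly z (f i))"
  by (induction I rule: infinite_finite_induct) (simp_all add: eval_poly_mult)

text \<open>
  Distinct monomials are linearly independent as functions. Fixing all variables but one leaves
  a polynomial in that variable with infinitely many roots; its coefficients are combinations of
  monomials that agree in one more exponent, which is what the hypothesis \<open>agree\<close> keeps track of.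
\<close>
lemma monomials_independent:
  fixes c :: "(nat \<Rightarrow> nat) \<Rightarrow> 'k::field_char_0"
  assumes "finite I" and "finite E" and agree: "\<And>e e' i. \<lbrakk>e \<in> E; e' \<in> E; i \<notin> I\<rbrakk> \<Longrightarrow> e i = e' i"
    and "\<And>z. (\<Sum>e \<in> E. c e * (\<Prod>i \<in> I. z i ^ e i)) = 0" and "e \<in> E"
  shows "c e = 0"
  using assms
proof (induction I arbitrary: E e rule: finite_induct)
  case empty
  then have "E = {e}" by blast
  then show ?case using empty.prems(3) by simp
next
  case (insert x I)
  let ?E = "\<lambda>k. {e' \<in> E. e' x = k}"
  have "(\<Sum>e' \<in> ?E k. c e' * (\<Prod>i \<in> I. z i ^ e' i)) = 0" for k and z :: "nat \<Rightarrow> 'k"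
  proof -
    define p where "p = (\<Sum>e' \<in> E. monom (c e' * (\<Prod>i \<in> I. z i ^ e' i)) (e' x))"
    have "poly p t = 0" for t
    proof -
      have "(\<Prod>i \<in> I. (z(x := t)) i ^ e' i) = (\<Prod>i \<in> I. z i ^ e' i)" for e'
        by (rule prod.cong) (use insert.hyps in auto)
      then show ?thesis
        using insert.prems(3)[of "z(x := t)"] insert.hyps
        by (simp add: p_def poly_sum poly_monom mult_ac)
    qed
    then have "p = 0" by (simp add: poly_eq_poly_eq_iff[symmetric] fun_eq_iff)
    then have "coeff p k = 0" by simp
    then show ?thesis
      using insert.prems(1)
      by (simp add: p_def coeff_sum sum.If_cases Int_def conj_commute)
  qed
  moreover have "e' i = e'' i" if "e' \<in> ?E (e x)" "e'' \<in> ?E (e x)" "i \<notin> I" for e' e'' i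
    using that insert.prems(2)[of e' e'' i] by (cases "i = x") auto
  ultimately show ?case
    by (intro insert.IH[of "?E (e x)" e]) (use insert.prems(1,4) in auto)
qed

lemma eval_poly_eq_zeroD:
  fixes p :: "'k::field_char_0 polynomial"
  assumes "\<And>z. eval_poly z p = 0"
  shows "p = 0"
proof (rule ccontr)
  assume "p \<noteq> 0"
  then obtain e where e: "Poly_Mapping.lookup p e \<noteq> 0"
    by (metis lookup_zero poly_mapping_eqI)
  define I where "I = (\<Union>e \<in> Poly_Mapping.keys p. Poly_Mapping.keys e)"
  let ?E = "Poly_Mapping.lookup ` Poly_Mapping.keys p"
  have inj: "inj_on Poly_Mapping.lookup (Poly_Mapping.keys p)"
    by (auto intro!: inj_onI poly_mapping_eqI)
  have "Poly_Mapping.lookup p (Abs_poly_mapping (Poly_Mapping.lookup e)) = 0"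
  proof (rule monomials_independent[where I = I and E = ?E
        and c = "\<lambda>e. Poly_Mapping.lookup p (Abs_poly_mapping e)"])
    show "finite I" by (simp add: I_def)
    show "(\<Sum>e \<in> ?E. Poly_Mapping.lookup p (Abs_poly_mapping e) * (\<Prod>i \<in> I. z i ^ e i)) = 0" for z
    proof -
      have "(\<Sum>e \<in> ?E. Poly_Mapping.lookup p (Abs_poly_mapping e) * (\<Prod>i \<in> I. z i ^ e i))
        = (\<Sum>e \<in> Poly_Mapping.keys p. Poly_Mapping.lookup p e * monomial_value z e)"
        unfolding sum.reindex[OF inj]
      proof (rule sum.cong)
        fix e assume "e \<in> Poly_Mapping.keys p"
        then have "monomial_value z e = (\<Prod>i \<in> I. z i ^ Poly_Mapping.lookup e i)"
          by (intro monomial_value_superset) (auto simp: I_def)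
        then show "((\<lambda>e. Poly_Mapping.lookup p (Abs_poly_mapping e) * (\<Prod>i \<in> I. z i ^ e i)) \<circ> Poly_Mapping.lookup) e
          = Poly_Mapping.lookup p e * monomial_value z e"
          by (simp add: Poly_Mapping.lookup_inverse)
      qed simp
      then show ?thesis
        using assms[of z] eval_poly_superset[of "Poly_Mapping.keys p" p z] by simp
    qed
    show "f i = f' i" if "f \<in> ?E" "f' \<in> ?E" "i \<notin> I" for f f' i
      using that by (auto simp: I_def in_keys_iff)
    show "Poly_Mapping.lookup e \<in> ?E" using e by (auto simp: in_keys_iff)
  qed simp
  then show False using e by (simp add: Poly_Mapping.lookup_inverse)
qed

text \<open>
  The field is infinite, so polynomial identities can be checked on values. This is how products,
  permutations of variables and the final uniqueness argument are handled throughout.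
\<close>
lemma eval_poly_inject:
  fixes p q :: "'k::field_char_0 polynomial"
  assumes "\<And>z. eval_poly z p = eval_poly z q"
  shows "p = q"
  using eval_poly_eq_zeroD[of "p - q"] assms by (simp add: eval_poly_diff)

lemma eval_permute_vars:
  assumes "\<pi> permutes S"
  shows "eval_poly z (permute_vars \<pi> p) = eval_poly (z \<circ> \<pi>) p"
proof -
  have inj: "inj \<pi>" and surj: "surj \<pi>"
    using assms by (simp_all add: permutes_inj permutes_surj)
  have inv: "inj (inv \<pi>)" using surj by (rule surj_imp_inj_inv)
  let ?k = "Poly_Mapping.map_key \<pi> :: monomial \<Rightarrow> monomial"
  let ?l = "Poly_Mapping.map_key (inv \<pi>) :: monomial \<Rightarrow> monomial"
  have kl: "?k (?l e) = e" and lk: "?l (?k e) = e" for e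
    by (rule poly_mapping_eqI,
        simp add: map_key.rep_eq[OF inj] map_key.rep_eq[OF inv] inv_f_f[OF inj] surj_f_inv_f[OF surj])+
  have lookup: "Poly_Mapping.lookup (permute_vars \<pi> p) e = Poly_Mapping.lookup p (?k e)" for e
    by (rule lookup_permute_vars[OF assms])
  have mval: "monomial_value z (?l e) = monomial_value (z \<circ> \<pi>) e" for e
  proof -
    have "Poly_Mapping.keys (?l e) = \<pi> ` Poly_Mapping.keys e"
    proof (rule set_eqI)
      fix i
      show "i \<in> Poly_Mapping.keys (?l e) \<longleftrightarrow> i \<in> \<pi> ` Poly_Mapping.keys e"
        using inv_f_f[OF inj] surj_f_inv_f[OF surj]
        unfolding keys_map_key[OF inv] vimage_def image_def mem_Collect_eq
        by metis
    qed
    then show ?thesis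
      using inj inv
      by (simp add: monomial_value_def prod.reindex inj_on_subset map_key.rep_eq)
  qed
  have "eval_poly z (permute_vars \<pi> p)
      = (\<Sum>e \<in> Poly_Mapping.keys (permute_vars \<pi> p). Poly_Mapping.lookup (permute_vars \<pi> p) e * monomial_value z e)"
    by (simp add: eval_poly_superset)
  also have "\<dots> = (\<Sum>e \<in> Poly_Mapping.keys p. Poly_Mapping.lookup p e * monomial_value (z \<circ> \<pi>) e)"
    by (rule sum.reindex_bij_witness[where i = ?l and j = ?k])
      (auto simp: kl lk lookup in_keys_iff mval[symmetric])
  also have "\<dots> = eval_poly (z \<circ> \<pi>) p"
    by (rule eval_poly_superset[OF finite_keys order_refl, symmetric])
  finally show ?thesis .
qed

section \<open>Vanishing of semisymmetric polynomials\<close>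

text \<open>
  The vanishing argument restricts a polynomial to a hyperplane and divides it by linear forms.
  Both operations are easier on functions than on coefficients, so the argument uses polynomial
  functions of \<open>z\<^sub>1, \<dots>, z\<^sub>n\<close> with an upper bound \<open>d\<close> for the degree.
\<close>
inductive poly_fun :: "nat \<Rightarrow> nat \<Rightarrow> ((nat \<Rightarrow> 'k) \<Rightarrow> 'k::comm_ring_1) \<Rightarrow> bool" for n where
  const: "poly_fun n d (\<lambda>_. c)"
| var: "i \<in> {1..n} \<Longrightarrow> poly_fun n 1 (\<lambda>z. z i)"
| add: "poly_fun n d f \<Longrightarrow> poly_fun n d g \<Longrightarrow> poly_fun n d (\<lambda>z. f z + g z)"
| mult: "poly_fun n d f \<Longrightarrow> poly_fun n d' g \<Longrightarrow> poly_fun n (d + d') (\<lambda>z. f z * g z)"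
| mono: "poly_fun n d f \<Longrightarrow> d \<le> d' \<Longrightarrow> poly_fun n d' f"

lemma poly_fun_diff:
  assumes "poly_fun n d f" "poly_fun n d g"
  shows "poly_fun n d (\<lambda>z. f z - g z)"
  using poly_fun.add[OF assms(1) poly_fun.mult[OF poly_fun.const[of n 0 "- 1"] assms(2), simplified]]
  by simp

lemma poly_fun_sum:
  "(\<And>i. i \<in> I \<Longrightarrow> poly_fun n d (f i)) \<Longrightarrow> poly_fun n d (\<lambda>z. \<Sum>i \<in> I. f i z)"
  by (induction I rule: infinite_finite_induct) (auto intro: poly_fun.const poly_fun.add)

lemma poly_fun_cong:
  assumes "poly_fun n d f" "\<And>i. i \<in> {1..n} \<Longrightarrow> z i = z' i"
  shows "f z = f z'"
  using assms by induction auto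

lemma poly_fun_update:
  assumes "poly_fun n d f"
  shows "poly_fun n d (\<lambda>z. f (z(i := c)))"
  using assms
proof induction
  case (var j)
  then show ?case
    using poly_fun.var[of j n] by (cases "j = i") (auto intro: poly_fun.const)
qed (auto intro: poly_fun.intros)

lemma poly_fun_restrict:
  assumes "poly_fun (Suc n) d f"
  shows "poly_fun n d (\<lambda>z. f (z(Suc n := c)))"
  using assms
proof induction
  case (var j)
  then show ?case
    using poly_fun.var[of j n] by (cases "j = Suc n") (auto intro: poly_fun.const)
qed (auto intro: poly_fun.intros)

lemma poly_fun_permute:
  assumes "poly_fun n d f" "\<pi> permutes {1..n}"
  shows "poly_fun n d (\<lambda>z. f (z \<circ> \<pi>))"
  using assms(1)
proof induction
  case (var j)
  then have "\<pi> j \<in> {1..n}" using assms(2) by (simp only: permutes_in_image)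
  then show ?case by (simp add: poly_fun.var[of "\<pi> j" n, simplified])
qed (auto intro: poly_fun.intros)

lemma poly_fun_univariate:
  assumes "poly_fun n d f"
  shows "\<exists>p. \<forall>t. f (z(i := t)) = poly p t"
  using assms
proof induction
  case (const d c)
  show ?case by (rule exI[of _ "[:c:]"]) simp
next
  case (var j)
  show ?case by (rule exI[of _ "if j = i then [:0, 1:] else [:z j:]"]) simp
next
  case (add d f g)
  then obtain p q where "\<forall>t. f (z(i := t)) = poly p t" "\<forall>t. g (z(i := t)) = poly q t" by blast
  then show ?case by (intro exI[of _ "p + q"]) (simp add: fun_upd_def)
next
  case (mult d f d' g)
  then obtain p q where "\<forall>t. f (z(i := t)) = poly p t" "\<forall>t. g (z(i := t)) = poly q t" by blast
  then show ?case by (intro exI[of _ "p * q"]) (simp add: fun_upd_def)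
qed

text \<open>
  Cancelling \<open>z\<^sub>i - c\<close> is immediate off the hyperplane \<open>z\<^sub>i = c\<close>. On it, the value is recovered by
  moving \<open>z\<^sub>i\<close>: along that line \<open>h\<close> is a polynomial in one variable, and \<open>'k poly\<close> has no zero divisors.
\<close>
lemma poly_fun_cancel_factor:
  fixes h :: "(nat \<Rightarrow> 'k::field_char_0) \<Rightarrow> 'k"
  assumes "poly_fun n d h" "\<And>z. (z i - c) * h z = 0"
  shows "h z = 0"
proof -
  obtain p where p: "h (z(i := t)) = poly p t" for t
    using poly_fun_univariate[OF assms(1)] by blast
  have "poly ([:- c, 1:] * p) t = 0" for t
    using assms(2)[of "z(i := t)"] by (auto simp: p)
  then have "[:- c, 1:] * p = 0" by (simp only: poly_eq_poly_eq_iff[symmetric]) (simp add: fun_eq_iff)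
  then have "p = 0" by (simp only: mult_eq_0_iff) simp
  then show ?thesis using p[of "z i"] by simp
qed

lemma poly_fun_cancel_factors:
  fixes h :: "(nat \<Rightarrow> 'k::field_char_0) \<Rightarrow> 'k"
  assumes "finite I" "I \<subseteq> {1..n}" "poly_fun n d h" "\<And>z. (\<Prod>i \<in> I. z i - c) * h z = 0"
  shows "h z = 0"
  using assms
proof (induction I arbitrary: d h z rule: finite_induct)
  case empty
  then show ?case by simp
next
  case (insert x I)
  have "poly_fun n (1 + d) (\<lambda>z. (z x - c) * h z)"
    using insert.prems by (intro poly_fun.mult poly_fun_diff poly_fun.var poly_fun.const) auto
  then have "(z x - c) * h z = 0" for z
    by (rule insert.IH[rotated]) (use insert in \<open>auto simp: mult_ac\<close>)
  then show ?case using poly_fun_cancel_factor[OF insert.prems(2)] by blast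
qed

text \<open>
  Division of \<open>f\<close> by \<open>z\<^sub>i - c\<close>. The clause for \<open>d = 0\<close> stands for degree \<open>- 1\<close>, which the natural
  number \<open>d - 1\<close> cannot express; with it, a polynomial with more linear factors than its degree
  allows is seen to be zero.
\<close>
lemma poly_fun_remainder:
  assumes "poly_fun n d f"
  shows "\<exists>g. poly_fun n (d - 1) g \<and> (d = 0 \<longrightarrow> g = (\<lambda>_. 0)) \<and>
    (\<forall>z. f z = f (z(i := c)) + (z i - c) * g z)"
  using assms
proof induction
  case (const d c)
  show ?case by (rule exI[of _ "\<lambda>_. 0"]) (simp add: poly_fun.const)
next
  case (var j)
  show ?case
    by (rule exI[of _ "\<lambda>_. if j = i then 1 else 0"]) (simp add: poly_fun.const)
next
  case (add d f g)
  then obtain f' g' where "poly_fun n (d - 1) f'" "d = 0 \<longrightarrow> f' = (\<lambda>_. 0)"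
      "\<forall>z. f z = f (z(i := c)) + (z i - c) * f' z"
    and "poly_fun n (d - 1) g'" "d = 0 \<longrightarrow> g' = (\<lambda>_. 0)"
      "\<forall>z. g z = g (z(i := c)) + (z i - c) * g' z" by blast
  then show ?case
    by (intro exI[of _ "\<lambda>z. f' z + g' z"]) (auto intro: poly_fun.add simp: fun_upd_def algebra_simps)
next
  case (mult d f d' g)
  then obtain f' g' where f': "poly_fun n (d - 1) f'" "d = 0 \<longrightarrow> f' = (\<lambda>_. 0)"
      "\<forall>z. f z = f (z(i := c)) + (z i - c) * f' z"
    and g': "poly_fun n (d' - 1) g'" "d' = 0 \<longrightarrow> g' = (\<lambda>_. 0)"
      "\<forall>z. g z = g (z(i := c)) + (z i - c) * g' z" by blast
  have "poly_fun n (d + d' - 1) (\<lambda>z. f' z * g z)"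
  proof (cases "d = 0")
    case True
    then show ?thesis using f'(2) by (simp add: poly_fun.const)
  next
    case False
    then show ?thesis using poly_fun.mult[OF f'(1) mult.hyps(2)] by simp
  qed
  moreover have "poly_fun n (d + d' - 1) (\<lambda>z. f (z(i := c)) * g' z)"
  proof (cases "d' = 0")
    case True
    then show ?thesis using g'(2) by (simp add: poly_fun.const)
  next
    case False
    then show ?thesis using poly_fun.mult[OF poly_fun_update[OF mult.hyps(1)] g'(1)] by simp
  qed
  ultimately have "poly_fun n (d + d' - 1) (\<lambda>z. f' z * g z + f (z(i := c)) * g' z)"
    by (rule poly_fun.add)
  moreover have "f z * g z = f (z(i := c)) * g (z(i := c))
      + (z i - c) * (f' z * g z + f (z(i := c)) * g' z)" for z
  proof -
    have "f z * g z = (f (z(i := c)) + (z i - c) * f' z) * g z"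
      using f'(3)[rule_format, of z] by (simp only:)
    also have "\<dots> = f (z(i := c)) * g z + (z i - c) * f' z * g z"
      by (rule distrib_right)
    also have "f (z(i := c)) * g z = f (z(i := c)) * (g (z(i := c)) + (z i - c) * g' z)"
      using g'(3)[rule_format, of z] by (simp only:)
    finally show ?thesis by (simp add: algebra_simps)
  qed
  moreover have "(\<lambda>z. f' z * g z + f (z(i := c)) * g' z) = (\<lambda>_. 0)" if "d + d' = 0"
    using f'(2) g'(2) that by simp
  ultimately show ?case by blast
next
  case (mono d f d')
  then obtain g where "poly_fun n (d - 1) g" "d = 0 \<longrightarrow> g = (\<lambda>_. 0)"
    "\<forall>z. f z = f (z(i := c)) + (z i - c) * g z" by blast
  moreover from this have "poly_fun n (d' - 1) g"
    using mono.hyps(2) by (auto intro: poly_fun.mono)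
  ultimately show ?case using mono.hyps(2) by (metis le_zero_eq)
qed

text \<open>
  A polynomial vanishing on several hyperplanes \<open>z\<^sub>i = c\<close> is divisible by the product of their
  equations: after one factor has been split off, the quotient still vanishes on the other
  hyperplanes, because the first factor can be cancelled there.
\<close>
lemma poly_fun_divide:
  fixes f :: "(nat \<Rightarrow> 'k::field_char_0) \<Rightarrow> 'k"
  assumes "finite I" "I \<subseteq> {1..n}" "poly_fun n d f"
    and "\<And>i z. i \<in> I \<Longrightarrow> z i = c \<Longrightarrow> f z = 0"
  shows "\<exists>g. poly_fun n (d - card I) g \<and> (d < card I \<longrightarrow> g = (\<lambda>_. 0)) \<and>
    (\<forall>z. f z = (\<Prod>i \<in> I. z i - c) * g z)"
  using assms
proof (induction I rule: finite_induct)
  case empty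
  then show ?case by (intro exI[of _ f]) simp
next
  case (insert x I)
  then obtain g where g: "poly_fun n (d - card I) g" "d < card I \<longrightarrow> g = (\<lambda>_. 0)"
    and f: "\<And>z. f z = (\<Prod>i \<in> I. z i - c) * g z" by blast
  have g0: "g (z(x := c)) = 0" for z
  proof (rule poly_fun_cancel_factors[where I = I and h = "\<lambda>z. g (z(x := c))"])
    show "poly_fun n (d - card I) (\<lambda>z. g (z(x := c)))" using g(1) by (rule poly_fun_update)
    show "(\<Prod>i \<in> I. z i - c) * g (z(x := c)) = 0" for z
    proof -
      have "(\<Prod>i \<in> I. (z(x := c)) i - c) = (\<Prod>i \<in> I. z i - c)"
        by (rule prod.cong) (use insert.hyps in auto)
      moreover have "f (z(x := c)) = 0" by (rule insert.prems(3)[of x]) simp_all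
      ultimately show ?thesis by (simp only: f[of "z(x := c)"])
    qed
  qed (use insert in auto)
  obtain g' where g': "poly_fun n (d - card I - 1) g'" "d - card I = 0 \<longrightarrow> g' = (\<lambda>_. 0)"
    "\<forall>z. g z = g (z(x := c)) + (z x - c) * g' z"
    using poly_fun_remainder[OF g(1)] by blast
  show ?case
    by (rule exI[of _ g']) (use g' g0 f insert.hyps in \<open>auto simp: mult_ac\<close>)
qed

lemma fun_upd_comp_permutes:
  assumes "\<pi> permutes S" "x \<notin> S"
  shows "(z \<circ> \<pi>)(x := c) = z(x := c) \<circ> \<pi>"
proof
  fix i
  have "\<pi> i = x \<longleftrightarrow> i = x"
    using assms by (metis permutes_not_in permutes_inj injD)
  then show "((z \<circ> \<pi>)(x := c)) i = (z(x := c) \<circ> \<pi>) i" by auto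
qed

lemma W_Suc: "\<pi> \<in> W n \<Longrightarrow> \<pi> \<in> W (Suc n)"
proof -
  assume "\<pi> \<in> W n"
  then have p: "\<pi> permutes {1..n}" and m: "\<forall>i \<in> {1..n}. \<pi> i mod 2 = i mod 2"
    by (auto simp: W_def)
  have "\<pi> permutes {1..Suc n}" by (rule permutes_subset[OF p]) auto
  moreover have "\<pi> i mod 2 = i mod 2" for i
    using m permutes_not_in[OF p] by (cases "i \<in> {1..n}") auto
  ultimately show ?thesis by (auto simp: W_def)
qed

text \<open>
  Adding 1 to all entries of a tuple raises \<open>odd_size\<close> by the left-hand side; the right-hand side
  is the number of factors that the vanishing argument splits off.
\<close>
lemma card_odd_le_card_parity:
  fixes n :: nat
  shows "card {i \<in> {1..n}. odd i} \<le> card {i \<in> {1..n}. i mod 2 = n mod 2}" (is "card ?A \<le> card ?B")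
proof (rule card_inj_on_le)
  show "inj_on (\<lambda>i. if odd n then i else Suc i) ?A" by (auto intro!: inj_onI split: if_splits)
  show "(\<lambda>i. if odd n then i else Suc i) ` ?A \<subseteq> ?B"
  proof safe
    fix i
    assume i: "i \<in> {1..n}" "odd i"
    have "Suc i \<le> n" if "even n" using i that by (cases "i = n") auto
    moreover have "Suc i mod 2 = n mod 2" if "even n" using i(2) that by presburger
    moreover have "i mod 2 = n mod 2" if "odd n" using i(2) that by presburger
    ultimately show "(if odd n then i else Suc i) \<in> {1..n}"
      "(if odd n then i else Suc i) mod 2 = n mod 2" using i(1) by auto
  qed
qed simp

text \<open>
  This is where the hypothesis on \<open>r\<close> enters: the linear forms \<open>z\<^sub>i - c\<close> do not vanish at the points
  \<open>c + \<rho> + \<mu>\<close> with positive entries \<open>\<mu>\<^sub>i\<close>.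
\<close>
lemma not_negative_rational_nonzero:
  fixes r :: "'k::field_char_0"
  assumes r: "\<not> (\<exists>q::rat. q < 0 \<and> r = of_rat q)"
  shows "of_nat k * r + of_nat (Suc l) \<noteq> 0"
proof
  assume eq: "of_nat k * r + of_nat (Suc l) = 0"
  show False
  proof (cases "k = 0")
    case True
    then have "of_nat (Suc l) = (0::'k)" using eq by (simp only: of_nat_0 mult_zero_left add_0_left)
    then show False by (simp only: of_nat_eq_0_iff)
  next
    case False
    then have "of_nat k \<noteq> (0::'k)" by simp
    then have "r = - of_nat (Suc l) / of_nat k"
      using eq by (metis add.inverse_inverse add_eq_0_iff minus_equation_iff mult.commute nonzero_eq_divide_eq)
    then have "r = of_rat (- of_nat (Suc l) / of_nat k)"
      by (simp only: of_rat_divide of_rat_minus of_rat_of_nat_eq)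
    moreover have "(- of_nat (Suc l) / of_nat k :: rat) < 0"
      using False by (simp add: divide_neg_pos)
    ultimately show False using r by blast
  qed
qed

text \<open>
  The points \<open>\<rho> + \<mu>\<close> with \<open>odd_size n \<mu> \<le> d\<close> separate the invariant polynomials of degree at most
  \<open>d\<close>. Induction on \<open>n\<close> and then on \<open>d\<close>. On the hyperplane \<open>z\<^sub>n = c\<close>, which contains the points with
  \<open>\<mu>\<^sub>n = 0\<close>, the polynomial \<open>f\<close> is an instance of the problem for \<open>n - 1\<close>, hence zero. By invariance it
  vanishes for \<open>z\<^sub>i = c\<close> whenever \<open>i\<close> has the parity of \<open>n\<close>, so it is divisible by the product of these
  \<open>z\<^sub>i - c\<close>. The quotient is again invariant, has smaller degree, and vanishes at the points with
  positive entries; subtracting 1 from all entries makes it an instance with \<open>c + 1\<close> in place of \<open>c\<close>.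
  The translation \<open>c\<close> is there to let both reductions stay inside the statement: passing from \<open>n\<close> to
  \<open>n - 1\<close> moves \<open>\<rho>\<close> by \<open>r\<close>.
\<close>
proposition semisymmetric_vanishing:
  fixes r :: "'k::field_char_0"
  assumes r: "\<not> (\<exists>q::rat. q < 0 \<and> r = of_rat q)"
    and "poly_fun n d f" "\<And>\<pi> z. \<pi> \<in> W n \<Longrightarrow> f (z \<circ> \<pi>) = f z"
    and "\<And>\<mu>. \<mu> \<in> \<Lambda> n \<Longrightarrow> odd_size n \<mu> \<le> d \<Longrightarrow> f (\<lambda>i. c + \<rho> n r i + of_nat (\<mu> i)) = 0"
  shows "f z = 0"
  using assms(2-)
proof (induction n arbitrary: d f c z)
  case 0
  have "f z = f (\<lambda>i. c + \<rho> 0 r i + of_nat ((\<lambda>_. 0) i))"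
    by (rule poly_fun_cong[OF 0(1)]) simp
  also have "\<dots> = 0" by (rule 0(3)) (simp_all add: \<Lambda>_def odd_size_def)
  finally show ?case .
next
  case (Suc n)
  note IH_n = Suc.IH
  show ?case
    using Suc.prems
  proof (induction d arbitrary: f c z rule: less_induct)
    case (less d)
    note inv = less.prems(2)
    let ?N = "Suc n"
    \<comment> \<open>The hyperplane carries the same problem in one variable less.\<close>
    have "f (z(?N := c)) = 0" for z
    proof (rule IH_n[where d = d and f = "\<lambda>z. f (z(?N := c))" and c = "c + r"])
      show "poly_fun n d (\<lambda>z. f (z(?N := c)))" by (rule poly_fun_restrict[OF less.prems(1)])
      show "f ((z \<circ> \<pi>)(?N := c)) = f (z(?N := c))" if "\<pi> \<in> W n" for \<pi> z
      proof -
        have "\<pi> permutes {1..n}" using that by (simp add: W_def)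
        then have "(z \<circ> \<pi>)(?N := c) = z(?N := c) \<circ> \<pi>" by (rule fun_upd_comp_permutes) simp
        then show ?thesis using inv[OF W_Suc[OF that]] by (simp only:)
      qed
      show "f ((\<lambda>i. c + r + \<rho> n r i + of_nat (\<mu> i))(?N := c)) = 0"
        if \<mu>: "\<mu> \<in> \<Lambda> n" "odd_size n \<mu> \<le> d" for \<mu>
      proof -
        have "\<mu> ?N = 0" using \<mu>(1) by (simp add: \<Lambda>_def)
        have "f ((\<lambda>i. c + r + \<rho> n r i + of_nat (\<mu> i))(?N := c))
            = f (\<lambda>i. c + \<rho> ?N r i + of_nat (\<mu> i))"
          by (rule poly_fun_cong[OF less.prems(1)])
            (auto simp: \<rho>_def \<open>\<mu> ?N = 0\<close> Suc_diff_le algebra_simps)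
        also have "\<dots> = 0"
        proof (rule less.prems(3))
          show "\<mu> \<in> \<Lambda> ?N" using \<mu>(1) \<open>\<mu> ?N = 0\<close> by (auto simp: \<Lambda>_def less_Suc_eq)
          have "odd_size ?N \<mu> = odd_size n \<mu>"
            unfolding odd_size_def by (rule sum.mono_neutral_right) (auto simp: \<open>\<mu> ?N = 0\<close> le_Suc_eq)
          then show "odd_size ?N \<mu> \<le> d" using \<mu>(2) by simp
        qed
        finally show ?thesis .
      qed
    qed
    then have f0: "f z = 0" if "z ?N = c" for z
      using that by (metis fun_upd_triv)
    define I where "I = {i \<in> {1..?N}. i mod 2 = ?N mod 2}"
    \<comment> \<open>Invariance carries the zero from the last variable to all variables of its parity.\<close>
    have fI: "f z = 0" if "i \<in> I" "z i = c" for i z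
    proof -
      have "transpose i ?N \<in> W ?N"
        using that(1) by (auto simp: W_def I_def permutes_swap_id Transposition.transpose_def)
      then have "f z = f (z \<circ> transpose i ?N)" using inv[of _ z] by (simp only:)
      also have "\<dots> = 0" by (rule f0) (simp add: that(2))
      finally show ?thesis .
    qed
    have fin: "finite I" and sub: "I \<subseteq> {1..?N}" by (auto simp: I_def)
    obtain g where g: "poly_fun ?N (d - card I) g" "d < card I \<longrightarrow> g = (\<lambda>_. 0)"
      and fg: "\<And>z. f z = (\<Prod>i \<in> I. z i - c) * g z"
      using poly_fun_divide[OF fin sub less.prems(1), of c] fI by blast
    have "?N \<in> I" "finite I" by (auto simp: I_def)
    then have card: "card I > 0" by (auto simp: card_gt_0_iff)
    show ?case
    proof (cases "d < card I")
      case True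
      then show ?thesis using g(2) fg by simp
    next
      case False
      have "g z = 0" for z
      proof (rule less.IH[of "d - card I" g "c + 1"])
        show "d - card I < d" using False card by simp
        show "poly_fun ?N (d - card I) g" by (rule g(1))
        show "g (z \<circ> \<pi>) = g z" if \<pi>: "\<pi> \<in> W ?N" for \<pi> z
        proof -
          have p: "\<pi> permutes {1..?N}" and m: "\<forall>i \<in> {1..?N}. \<pi> i mod 2 = i mod 2"
            using \<pi> by (auto simp: W_def)
          have sub: "\<pi> ` I \<subseteq> I" using m permutes_in_image[OF p] unfolding I_def by fastforce
          have "inj_on \<pi> I" using permutes_inj[OF p] by (rule inj_on_subset) simp
          then have bij: "bij_betw \<pi> I I"
            using sub \<open>finite I\<close> by (simp add: bij_betw_def endo_inj_surj)
          have "g (z \<circ> \<pi>) - g z = 0"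
          proof (rule poly_fun_cancel_factors[where I = I and h = "\<lambda>z. g (z \<circ> \<pi>) - g z"])
            show "poly_fun ?N (d - card I) (\<lambda>z. g (z \<circ> \<pi>) - g z)"
              by (intro poly_fun_diff poly_fun_permute g(1) p)
            show "(\<Prod>i \<in> I. z i - c) * (g (z \<circ> \<pi>) - g z) = 0" for z
            proof -
              have "(\<Prod>i \<in> I. z i - c) = (\<Prod>i \<in> I. (z \<circ> \<pi>) i - c)"
                using prod.reindex_bij_betw[OF bij, of "\<lambda>i. z i - c"] by simp
              then have "(\<Prod>i \<in> I. z i - c) * (g (z \<circ> \<pi>) - g z) = f (z \<circ> \<pi>) - f z"
                by (simp only: fg[of z] fg[of "z \<circ> \<pi>"] right_diff_distrib)
              then show ?thesis using inv[OF \<pi>] by simp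
            qed
          qed (use \<open>finite I\<close> in \<open>auto simp: I_def\<close>)
          then show ?thesis by simp
        qed
        \<comment> \<open>Adding 1 to all entries of \<open>\<mu>\<close> leads back to a zero of \<open>f\<close> off the hyperplanes.\<close>
        show "g (\<lambda>i. c + 1 + \<rho> ?N r i + of_nat (\<mu> i)) = 0"
          if \<mu>: "\<mu> \<in> \<Lambda> ?N" "odd_size ?N \<mu> \<le> d - card I" for \<mu>
        proof -
          define \<mu>' where "\<mu>' i = (if i \<in> {1..?N} then \<mu> i + 1 else 0)" for i
          let ?z = "\<lambda>i. c + \<rho> ?N r i + of_nat (\<mu>' i)"
          have "\<mu>' \<in> \<Lambda> ?N" using \<mu>(1) by (auto simp: \<Lambda>_def \<mu>'_def)
          moreover have "odd_size ?N \<mu>' = odd_size ?N \<mu> + card {i \<in> {1..?N}. odd i}"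
          proof -
            have "odd_size ?N \<mu>' = (\<Sum>i \<in> {i \<in> {1..?N}. odd i}. \<mu> i + 1)"
              unfolding odd_size_def by (rule sum.cong) (auto simp: \<mu>'_def)
            then show ?thesis by (simp only: sum.distrib odd_size_def) simp
          qed
          then have "odd_size ?N \<mu>' \<le> d"
            using \<mu>(2) card_odd_le_card_parity[of ?N] False by (simp add: I_def)
          ultimately have "f ?z = 0" by (rule less.prems(3))
          moreover have "?z i - c \<noteq> 0" if "i \<in> I" for i
            using that not_negative_rational_nonzero[OF r, of "?N - i" "\<mu> i"]
            by (simp add: \<rho>_def \<mu>'_def I_def)
          then have "(\<Prod>i \<in> I. ?z i - c) \<noteq> 0" using \<open>finite I\<close> by (simp add: prod_zero_iff)
          ultimately have "g ?z = 0" using fg[of ?z] by simp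
          moreover have "g (\<lambda>i. c + 1 + \<rho> ?N r i + of_nat (\<mu> i)) = g ?z"
            by (rule poly_fun_cong[OF g(1)]) (simp add: \<mu>'_def)
          ultimately show ?thesis by simp
        qed
      qed
      then show ?thesis using fg by simp
    qed
  qed
qed

section \<open>Uniqueness\<close>

text \<open>
  Only upper bounds for the degree pass to differences; the exact degree of the product in the theorem is
  read off at the end from its distinguished monomial.
\<close>
definition degree_le :: "nat \<Rightarrow> nat \<Rightarrow> 'k::comm_ring_1 polynomial set" where
  "degree_le n d = {p \<in> poly_ring n. \<forall>e \<in> Poly_Mapping.keys p. monomial_degree e \<le> d}"

lemma monomial_degree_superset:
  assumes "finite J" "Poly_Mapping.keys e \<subseteq> J"
  shows "monomial_degree e = (\<Sum>i \<in> J. Poly_Mapping.lookup e i)"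
  unfolding monomial_degree_def
  by (rule sum.mono_neutral_left) (use assms in \<open>auto simp: in_keys_iff\<close>)

lemma monomial_degree_add: "monomial_degree (e + e') = monomial_degree e + monomial_degree e'"
proof -
  let ?J = "Poly_Mapping.keys e \<union> Poly_Mapping.keys e'"
  have "monomial_degree (e + e') = (\<Sum>i \<in> ?J. Poly_Mapping.lookup (e + e') i)"
    by (rule monomial_degree_superset) (use keys_add[of e e'] in auto)
  also have "\<dots> = monomial_degree e + monomial_degree e'"
    using monomial_degree_superset[of ?J e] monomial_degree_superset[of ?J e']
    by (simp add: lookup_add sum.distrib)
  finally show ?thesis .
qed

lemma total_degree_le_iff:
  "total_degree p \<le> d \<longleftrightarrow> (\<forall>e \<in> Poly_Mapping.keys p. monomial_degree e \<le> d)"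
  by (simp add: total_degree_def)

lemma degree_le_mult:
  assumes "p \<in> degree_le n d" "q \<in> degree_le n d'"
  shows "p * q \<in> degree_le n (d + d')"
proof -
  have "Poly_Mapping.keys e \<subseteq> {1..n} \<and> monomial_degree e \<le> d + d'"
    if e: "e \<in> Poly_Mapping.keys (p * q)" for e
  proof -
    obtain a b where ab: "e = a + b" "a \<in> Poly_Mapping.keys p" "b \<in> Poly_Mapping.keys q"
      using keys_mult[of p q] e by fast
    then have "Poly_Mapping.keys a \<subseteq> {1..n}" "Poly_Mapping.keys b \<subseteq> {1..n}"
      "monomial_degree a \<le> d" "monomial_degree b \<le> d'"
      using assms by (auto simp: degree_le_def poly_ring_def)
    then show ?thesis
      using keys_add[of a b] unfolding ab(1) monomial_degree_add by (metis Un_least add_mono subset_trans)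
  qed
  then show ?thesis by (auto simp: degree_le_def poly_ring_def)
qed

lemma degree_le_diff:
  assumes "p \<in> degree_le n d" "q \<in> degree_le n d"
  shows "p - q \<in> degree_le n d"
proof -
  have "Poly_Mapping.keys (p - q) \<subseteq> Poly_Mapping.keys p \<union> Poly_Mapping.keys q"
    by (auto simp: in_keys_iff lookup_minus)
  then show ?thesis using assms by (fastforce simp: degree_le_def poly_ring_def)
qed

lemma degree_le_of_nat: "of_nat j \<in> degree_le n d"
  by (auto simp: degree_le_def poly_ring_def in_keys_iff lookup_of_nat when_def monomial_degree_def
      split: if_splits)

lemma poly_fun_monomial:
  assumes "finite J" "J \<subseteq> {1..n}"
  shows "poly_fun n (\<Sum>i \<in> J. e i) (\<lambda>z. \<Prod>i \<in> J. z i ^ e i)"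
  using assms
proof (induction J rule: finite_induct)
  case empty
  show ?case by (simp add: poly_fun.const)
next
  case (insert x J)
  have pow: "poly_fun n k (\<lambda>z. z x ^ k)" for k
  proof (induction k)
    case 0
    show ?case by (simp add: poly_fun.const)
  next
    case (Suc k)
    then show ?case using poly_fun.mult[OF poly_fun.var[of x n] Suc] insert.prems by simp
  qed
  then show ?case
    using insert poly_fun.mult[OF pow] by simp
qed

lemma poly_fun_eval_poly:
  assumes "p \<in> degree_le n d"
  shows "poly_fun n d (\<lambda>z. eval_poly z p)"
  unfolding eval_poly_def
proof (rule poly_fun_sum)
  fix e assume e: "e \<in> Poly_Mapping.keys p"
  then have "poly_fun n (0 + (\<Sum>i \<in> Poly_Mapping.keys e. Poly_Mapping.lookup e i))
    (\<lambda>z. Poly_Mapping.lookup p e * (\<Prod>i \<in> Poly_Mapping.keys e. z i ^ Poly_Mapping.lookup e i))"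
    using assms
    by (intro poly_fun.mult poly_fun.const poly_fun_monomial) (auto simp: degree_le_def poly_ring_def)
  then show "poly_fun n d
    (\<lambda>z. Poly_Mapping.lookup p e * (\<Prod>i \<in> Poly_Mapping.keys e. z i ^ Poly_Mapping.lookup e i))"
    by (rule poly_fun.mono) (use assms e in \<open>auto simp: degree_le_def monomial_degree_def\<close>)
qed

lemma permute_vars_invariant_iff:
  fixes p :: "'k::field_char_0 polynomial"
  assumes "\<pi> permutes S"
  shows "permute_vars \<pi> p = p \<longleftrightarrow> (\<forall>z. eval_poly (z \<circ> \<pi>) p = eval_poly z p)"
  using eval_poly_inject[of "permute_vars \<pi> p" p] eval_permute_vars[OF assms, of _ p] by metis

text \<open>
  A solution is determined by its value at \<open>l\<close>, because the difference of two solutions with the same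
  value there vanishes at all points and is zero. In particular that value is not zero, since the
  zero polynomial does not have the prescribed coefficient, and two solutions are proportional.
  The coefficient 1 then makes them equal.
\<close>
lemma is_R_unique:
  fixes r :: "'k::field_char_0"
  assumes r: "\<not> (\<exists>q::rat. q < 0 \<and> r = of_rat q)"
    and p: "is_R n r l p" and q: "is_R n r l q"
  shows "p = q"
proof -
  define d where "d = odd_size n l"
  define w where "w \<mu> = (\<lambda>i. 0 + \<rho> n r i + of_nat (\<mu> i))" for \<mu>
  have pf: "poly_fun n d (\<lambda>z. eval_poly z s)" if "is_R n r l s" for s
    using that total_degree_le_iff[of s d]
    by (intro poly_fun_eval_poly) (auto simp: is_R_def d_def degree_le_def)
  have inv: "eval_poly (z \<circ> \<pi>) s = eval_poly z s" if "is_R n r l s" "\<pi> \<in> W n" for s \<pi> z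
    using that permute_vars_invariant_iff[of \<pi> "{1..n}" s] by (auto simp: is_R_def W_def)
  have van: "eval_poly (w \<mu>) s = 0" if "is_R n r l s" "\<mu> \<in> \<Lambda> n" "odd_size n \<mu> \<le> d" "\<mu> \<noteq> l" for s \<mu>
    using that by (simp add: is_R_def w_def d_def)
  let ?f = "\<lambda>z. eval_poly (w l) q * eval_poly z p - eval_poly (w l) p * eval_poly z q"
  \<comment> \<open>The combination is chosen to vanish at \<open>l\<close> as well.\<close>
  have lin: "?f z = 0" for z
  proof (rule semisymmetric_vanishing[OF r, where n = n and d = d and c = 0 and f = ?f])
    show "poly_fun n d ?f"
      using poly_fun.mult[OF poly_fun.const[of n 0] pf[OF p]] poly_fun.mult[OF poly_fun.const[of n 0] pf[OF q]]
      by (intro poly_fun_diff) simp_all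
    show "?f (z \<circ> \<pi>) = ?f z" if "\<pi> \<in> W n" for \<pi> z
      using inv[OF p that] inv[OF q that] by (simp only:)
    show "?f (\<lambda>i. 0 + \<rho> n r i + of_nat (\<mu> i)) = 0" if "\<mu> \<in> \<Lambda> n" "odd_size n \<mu> \<le> d" for \<mu>
      unfolding w_def[symmetric]
      using van[OF p that] van[OF q that] by (cases "\<mu> = l") (simp_all add: mult.commute)
  qed
  have nz: "eval_poly (w l) s \<noteq> 0" if s: "is_R n r l s" for s
  proof
    assume 0: "eval_poly (w l) s = 0"
    have "eval_poly z s = 0" for z
    proof (rule semisymmetric_vanishing[OF r pf[OF s], where c = 0])
      show "eval_poly (z \<circ> \<pi>) s = eval_poly z s" if "\<pi> \<in> W n" for \<pi> z
        by (rule inv[OF s that])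
      show "eval_poly (\<lambda>i. 0 + \<rho> n r i + of_nat (\<mu> i)) s = 0" if "\<mu> \<in> \<Lambda> n" "odd_size n \<mu> \<le> d" for \<mu>
        unfolding w_def[symmetric] using van[OF s that] 0 by (cases "\<mu> = l") simp_all
    qed
    then have "s = 0" by (rule eval_poly_eq_zeroD)
    then show False using s by (simp add: is_R_def)
  qed
  let ?c = "Poly_Mapping.single (0::monomial)"
  have "?c (eval_poly (w l) q) * p = ?c (eval_poly (w l) p) * q"
    using lin by (intro eval_poly_inject) (simp add: eval_poly_mult eval_poly_single monomial_value_def)
  then have eq: "Poly_Mapping.map ((*) (eval_poly (w l) q)) p = Poly_Mapping.map ((*) (eval_poly (w l) p)) q"
    by (simp only: mult_map_scale_conv_mult)
  have scaled: "eval_poly (w l) q * Poly_Mapping.lookup p e = eval_poly (w l) p * Poly_Mapping.lookup q e" for e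
    using arg_cong[OF eq, of "\<lambda>f. Poly_Mapping.lookup f e"] by (simp add: Poly_Mapping.map.rep_eq when_def split: if_splits)
  moreover have "Poly_Mapping.lookup p (bracket_monomial n l) = 1" "Poly_Mapping.lookup q (bracket_monomial n l) = 1"
    using p q by (simp_all add: is_R_def)
  ultimately have "eval_poly (w l) q = eval_poly (w l) p" by (metis mult_1_right)
  then have "Poly_Mapping.lookup p e = Poly_Mapping.lookup q e" for e
    using scaled[of e] nz[OF p] by simp
  then show ?thesis by (rule poly_mapping_eqI)
qed

lemma R_eqI:
  fixes r :: "'k::field_char_0"
  assumes "\<not> (\<exists>q::rat. q < 0 \<and> r = of_rat q)" "is_R n r l p"
  shows "R n r l = p"
  unfolding R_def by (rule the_equality) (use assms is_R_unique in blast)+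

section \<open>Elementary symmetric polynomials\<close>

definition squarefree_monomial :: "nat set \<Rightarrow> monomial" where
  "squarefree_monomial S = (\<Sum>i \<in> S. Poly_Mapping.single i 1)"

lemma lookup_squarefree_monomial:
  "finite S \<Longrightarrow> Poly_Mapping.lookup (squarefree_monomial S) i = (if i \<in> S then 1 else 0)"
  by (simp add: squarefree_monomial_def lookup_sum lookup_single when_def)

lemma keys_squarefree_monomial: "finite S \<Longrightarrow> Poly_Mapping.keys (squarefree_monomial S) = S"
  by (auto simp: in_keys_iff lookup_squarefree_monomial split: if_splits)

lemma squarefree_monomial_inject:
  "\<lbrakk>finite S; finite T; squarefree_monomial S = squarefree_monomial T\<rbrakk> \<Longrightarrow> S = T"
  by (metis keys_squarefree_monomial)

lemma monomial_degree_squarefree_monomial: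
  "finite S \<Longrightarrow> monomial_degree (squarefree_monomial S) = card S"
  by (simp add: monomial_degree_def keys_squarefree_monomial lookup_squarefree_monomial)

lemma monomial_value_squarefree_monomial:
  "finite S \<Longrightarrow> monomial_value z (squarefree_monomial S) = (\<Prod>i \<in> S. z i)"
  by (simp add: monomial_value_def keys_squarefree_monomial lookup_squarefree_monomial)

text \<open>
  A linear combination of the elementary symmetric polynomials in the variables of \<open>I\<close>.
\<close>
definition subset_poly :: "(nat \<Rightarrow> 'k) \<Rightarrow> nat set \<Rightarrow> 'k::comm_ring_1 polynomial" where
  "subset_poly c I = (\<Sum>S \<in> Pow I. Poly_Mapping.single (squarefree_monomial S) (c (card S)))"

lemma eval_subset_poly:
  assumes "finite I"
  shows "eval_poly z (subset_poly c I) = (\<Sum>S \<in> Pow I. c (card S) * (\<Prod>i \<in> S. z i))"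
  unfolding subset_poly_def eval_poly_sum eval_poly_single
  by (rule sum.cong)
    (use assms in \<open>auto simp: monomial_value_squarefree_monomial finite_subset\<close>)

lemma lookup_subset_poly:
  assumes "finite I" "finite T"
  shows "Poly_Mapping.lookup (subset_poly c I) (squarefree_monomial T) = (if T \<subseteq> I then c (card T) else 0)"
proof -
  have "squarefree_monomial S = squarefree_monomial T \<longleftrightarrow> S = T" if "S \<in> Pow I" for S
    using that assms squarefree_monomial_inject[of S T] by (auto dest: finite_subset)
  then have "Poly_Mapping.lookup (subset_poly c I) (squarefree_monomial T)
      = (\<Sum>S \<in> Pow I. if S = T then c (card S) else 0)"
    unfolding subset_poly_def lookup_sum lookup_single when_def by (intro sum.cong refl) auto
  then show ?thesis using assms by (simp add: sum.delta)
qed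

lemma keys_subset_poly:
  assumes "finite I" "e \<in> Poly_Mapping.keys (subset_poly c I)"
  obtains S where "S \<subseteq> I" "c (card S) \<noteq> 0" "e = squarefree_monomial S"
proof -
  have "Poly_Mapping.lookup (subset_poly c I) e \<noteq> 0" using assms(2) by (simp add: in_keys_iff)
  then obtain S where "S \<in> Pow I"
    "Poly_Mapping.lookup (Poly_Mapping.single (squarefree_monomial S) (c (card S))) e \<noteq> 0"
    unfolding subset_poly_def lookup_sum by (rule sum.not_neutral_contains_not_neutral)
  then show thesis using that by (auto simp: lookup_single when_def split: if_splits)
qed

lemma subset_poly_degree_le:
  assumes "finite I" "I \<subseteq> {1..n}" "\<And>s. s \<le> card I \<Longrightarrow> k < s \<Longrightarrow> c s = 0"
  shows "subset_poly c I \<in> degree_le n k"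
proof -
  have "Poly_Mapping.keys e \<subseteq> {1..n} \<and> monomial_degree e \<le> k"
    if e: "e \<in> Poly_Mapping.keys (subset_poly c I)" for e
  proof -
    obtain S where S: "S \<subseteq> I" "c (card S) \<noteq> 0" "e = squarefree_monomial S"
      by (rule keys_subset_poly[OF assms(1) e])
    moreover have "finite S" using S(1) assms(1) by (rule finite_subset)
    ultimately show ?thesis
      using assms card_mono[OF assms(1) S(1)]
      by (auto simp: keys_squarefree_monomial monomial_degree_squarefree_monomial intro: leI)
  qed
  then show ?thesis by (auto simp: degree_le_def poly_ring_def)
qed

section \<open>Divided differences\<close>

text \<open>
  For monic \<open>M\<close> with \<open>degree M\<close> distinct roots this is the divided difference of \<open>p\<close> at the roots of \<open>M\<close>. The
  description by remainders makes sense for repeated roots too (as for \<open>r = 0\<close>), and shows at once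
  that the functional is linear, kills the multiples of \<open>M\<close>, kills all degrees below
  \<open>degree M - 1\<close>, and takes the leading coefficient in that degree.
\<close>
definition divided_difference :: "'k::field_char_0 poly \<Rightarrow> 'k poly \<Rightarrow> 'k" where
  "divided_difference M p = coeff (p mod M) (degree M - 1)"

lemma divided_difference_add:
  "divided_difference M (p + q) = divided_difference M p + divided_difference M q"
  by (simp add: divided_difference_def poly_mod_add_left)

lemma divided_difference_smult:
  "divided_difference M (smult c p) = c * divided_difference M p"
  by (simp add: divided_difference_def mod_smult_left)

lemma divided_difference_zero: "divided_difference M 0 = 0"
  by (simp add: divided_difference_def)

lemma divided_difference_sum:
  "divided_difference M (\<Sum>i \<in> I. f i) = (\<Sum>i \<in> I. divided_difference M (f i))"
  by (induction I rule: infinite_finite_induct)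
    (simp_all add: divided_difference_zero divided_difference_add)

lemma divided_difference_dvd: "M dvd p \<Longrightarrow> divided_difference M p = 0"
  by (simp add: divided_difference_def)

lemma divided_difference_small:
  assumes "degree p < degree M"
  shows "divided_difference M p = coeff p (degree M - 1)"
  using assms by (simp add: divided_difference_def mod_poly_less)

text \<open>
  Expanding \<open>u * (\<Prod>i \<in> I. v - z\<^sub>i)\<close> and applying the functional gives an element of the polynomial ring;
  these are its coefficients, up to the sign \<open>(- 1) ^ k\<close> that normalizes the top ones.
\<close>
definition signed_differences ::
    "'k::field_char_0 poly \<Rightarrow> 'k poly \<Rightarrow> 'k poly \<Rightarrow> nat set \<Rightarrow> nat \<Rightarrow> nat \<Rightarrow> 'k" where
  "signed_differences M u v I k s = (- 1) ^ (k + s) * divided_difference M (u * v ^ (card I - s))"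

lemma eval_signed_differences:
  fixes M :: "'k::field_char_0 poly"
  assumes "finite I"
  shows "eval_poly z (subset_poly (signed_differences M u v I k) I)
    = (- 1) ^ k * divided_difference M (u * (\<Prod>i \<in> I. v - [:z i:]))"
proof -
  have "(\<Prod>i \<in> I. v - [:z i:]) = (\<Prod>i \<in> I. [:- z i:] + v)"
    by (rule prod.cong) (simp_all add: diff_conv_add_uminus add.commute del: add_uminus_conv_diff)
  also have "\<dots> = (\<Sum>S \<in> Pow I. (\<Prod>i \<in> S. [:- z i:]) * (\<Prod>i \<in> I - S. v))"
    by (rule prod_add[OF assms])
  also have "\<dots> = (\<Sum>S \<in> Pow I. smult ((- 1) ^ card S * (\<Prod>i \<in> S. z i)) (v ^ (card I - card S)))"
  proof (rule sum.cong[OF refl])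
    fix S assume "S \<in> Pow I"
    then have S: "S \<subseteq> I" "finite S" using assms by (auto dest: finite_subset)
    have "(\<Prod>i \<in> S. [:- z i:]) = [:(- 1) ^ card S * (\<Prod>i \<in> S. z i):]"
      using S(2) by (induction S rule: finite_induct) (simp_all add: one_pCons)
    then show "(\<Prod>i \<in> S. [:- z i:]) * (\<Prod>i \<in> I - S. v)
      = smult ((- 1) ^ card S * (\<Prod>i \<in> S. z i)) (v ^ (card I - card S))"
      using S by (simp add: card_Diff_subset)
  qed
  finally have "u * (\<Prod>i \<in> I. v - [:z i:])
      = (\<Sum>S \<in> Pow I. smult ((- 1) ^ card S * (\<Prod>i \<in> S. z i)) (u * v ^ (card I - card S)))"
    by (simp add: sum_distrib_left)
  then have "divided_difference M (u * (\<Prod>i \<in> I. v - [:z i:])) =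
      (\<Sum>S \<in> Pow I. (- 1) ^ card S * (\<Prod>i \<in> S. z i) * divided_difference M (u * v ^ (card I - card S)))"
    by (simp only: divided_difference_sum divided_difference_smult)
  then show ?thesis
    by (simp add: eval_subset_poly[OF assms] signed_differences_def sum_distrib_left power_add mult_ac)
qed

section \<open>The polynomials of columns of odd length\<close>

definition odds :: "nat \<Rightarrow> nat set" where "odds n = {i \<in> {1..n}. odd i}"
definition evens :: "nat \<Rightarrow> nat set" where "evens n = {i \<in> {1..n}. even i}"

lemma finite_odds [simp]: "finite (odds n)" and finite_evens [simp]: "finite (evens n)"
  by (simp_all add: odds_def evens_def)

lemma odds_0 [simp]: "odds 0 = {}" and evens_0 [simp]: "evens 0 = {}"
  by (simp_all add: odds_def evens_def)

lemma odds_Suc: "odds (Suc n) = (if even n then insert (Suc n) (odds n) else odds n)"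
  by (auto simp: odds_def le_Suc_eq)

lemma evens_Suc: "evens (Suc n) = (if even n then evens n else insert (Suc n) (evens n))"
  by (auto simp: evens_def le_Suc_eq)

lemma Suc_notin: "Suc n \<notin> odds n" "Suc n \<notin> evens n"
  by (simp_all add: odds_def evens_def)

lemma odd_imp_one_le: "odd m \<Longrightarrow> m \<le> n \<Longrightarrow> 1 \<le> (n::nat)"
  using odd_pos[of m] by linarith

lemma one_mem_odds: "odd m \<Longrightarrow> m \<le> n \<Longrightarrow> 1 \<in> odds n"
  using odd_imp_one_le[of m n] by (simp add: odds_def)

lemma card_odds: "card (odds n) = Suc n div 2"
  by (induction n) (auto simp: odds_Suc Suc_notin elim!: oddE)

lemma card_evens: "card (evens n) = n div 2"
  by (induction n) (auto simp: evens_Suc Suc_notin elim!: oddE)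

text \<open>
  If \<open>\<mu>\<^sub>m = 0\<close>, then \<open>\<rho> + \<mu>\<close> agrees with \<open>\<rho>\<close> in all positions from \<open>m\<close> on, so the roots of this
  modulus are entries of \<open>\<rho> + \<mu>\<close> with odd index.
\<close>
definition column_modulus :: "nat \<Rightarrow> 'k::field_char_0 \<Rightarrow> nat \<Rightarrow> 'k poly" where
  "column_modulus n r m = (\<Prod>i \<in> {i \<in> odds n. m \<le> i}. [:- \<rho> n r i, 1:])"

definition odd_part :: "nat \<Rightarrow> (nat \<Rightarrow> 'k::field_char_0) \<Rightarrow> 'k poly" where
  "odd_part n z = (\<Prod>i \<in> odds n. [:- z i, 1:])"

text \<open>
  The even variables are moved by \<open>r\<close>, so that \<open>z\<^sub>i\<^sub>+\<^sub>1\<close> lies over the same \<open>\<rho>\<^sub>i\<close> as its odd neighbour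
  \<open>z\<^sub>i\<close>. For odd \<open>n\<close> the last odd variable has no neighbour, and the factor \<open>[:0, 1:]\<close> fills the gap
  with the root \<open>\<rho>\<^sub>n = 0\<close>.
\<close>
definition even_part :: "nat \<Rightarrow> 'k::field_char_0 \<Rightarrow> (nat \<Rightarrow> 'k) \<Rightarrow> 'k poly" where
  "even_part n r z = [:0, 1:] ^ (n mod 2) * (\<Prod>i \<in> evens n. [:- (z i + r), 1:])"

text \<open>
  For odd \<open>m\<close> this turns out to be the polynomial of the column \<open>(1\<^sup>m)\<close>. Each of the two terms is a
  shifted elementary symmetric polynomial, of degree at most \<open>card (odds m)\<close>, in the odd or in the
  even variables. Either one vanishes at \<open>\<rho> + \<mu>\<close> if \<open>\<mu>\<^sub>m = 0\<close>; their difference also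
  vanishes if \<open>\<mu>\<^sub>1 = \<mu>\<^sub>2\<close>, \<open>\<mu>\<^sub>3 = \<mu>\<^sub>4\<close> and so on, with \<open>\<mu>\<^sub>n\<^sub>+\<^sub>1 = 0\<close>.
\<close>
definition column_poly :: "nat \<Rightarrow> 'k::field_char_0 \<Rightarrow> nat \<Rightarrow> 'k polynomial" where
  "column_poly n r m =
     subset_poly (signed_differences (column_modulus n r m) 1 [:0, 1:] (odds n) (card (odds m))) (odds n)
   - subset_poly (signed_differences (column_modulus n r m) ([:0, 1:] ^ (n mod 2)) [:- r, 1:] (evens n) (card (odds m))) (evens n)"

lemma eval_column_poly:
  "eval_poly z (column_poly n r m) = (- 1) ^ card (odds m) *
     (divided_difference (column_modulus n r m) (odd_part n z)
      - divided_difference (column_modulus n r m) (even_part n r z))"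
  by (simp add: column_poly_def eval_poly_diff eval_signed_differences odd_part_def even_part_def
      right_diff_distrib add.commute)

lemma degree_prod_linear:
  "finite I \<Longrightarrow> degree (\<Prod>i \<in> I. [:f i, 1:] :: 'k::field poly) = card I"
  by (subst degree_prod_eq_sum_degree) auto

lemma degree_column_modulus:
  assumes "odd m" "m \<le> n"
  shows "degree (column_modulus n r m) = Suc (card (odds n) - card (odds m))"
    and "card (odds m) \<le> card (odds n)"
proof -
  have eq: "insert m {i \<in> odds n. m \<le> i} = {i \<in> odds n. m \<le> i}"
    using assms by (auto simp: odds_def odd_pos Suc_leI)
  have "odds n = odds m \<union> ({i \<in> odds n. m \<le> i} - {m})"
    using assms by (auto simp: odds_def)
  moreover have "odds m \<inter> ({i \<in> odds n. m \<le> i} - {m}) = {}" by (auto simp: odds_def)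
  ultimately have "card (odds n) = card (odds m) + card ({i \<in> odds n. m \<le> i} - {m})"
    by (metis card_Un_disjoint finite_odds finite_Un)
  moreover have "card {i \<in> odds n. m \<le> i} = Suc (card ({i \<in> odds n. m \<le> i} - {m}))"
    by (subst eq[symmetric]) (simp add: card.insert_remove)
  ultimately show "degree (column_modulus n r m) = Suc (card (odds n) - card (odds m))"
    and "card (odds m) \<le> card (odds n)"
    by (simp_all add: column_modulus_def degree_prod_linear)
qed

text \<open>
  The polynomial \<open>u * v ^ (card I - s)\<close> is monic of degree \<open>card (odds n) - s\<close>, while the functional
  sees only degrees from \<open>card (odds n) - card (odds m)\<close> on. So no monomial has degree above
  \<open>card (odds m)\<close>, and those of this degree have coefficient 1.
\<close>
lemma signed_differences_column:
  fixes u v :: "'k::field_char_0 poly"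
  assumes "odd m" "m \<le> n" and uv: "lead_coeff u = 1" "lead_coeff v = 1" "degree v = 1"
    and deg: "degree u + card I = card (odds n)" and s: "s \<le> card I"
  shows "card (odds m) < s \<Longrightarrow> signed_differences (column_modulus n r m) u v I (card (odds m)) s = 0"
    and "card (odds m) = s \<Longrightarrow> signed_differences (column_modulus n r m) u v I (card (odds m)) s = 1"
proof -
  let ?k = "card (odds m)" and ?N = "card (odds n)" and ?M = "column_modulus n r m"
  let ?p = "u * v ^ (card I - s)"
  note M = degree_column_modulus[OF assms(1,2)]
  have "u \<noteq> 0" "v \<noteq> 0" using uv by auto
  then have d: "degree ?p = ?N - s"
    using uv(3) deg s by (simp add: degree_mult_eq degree_power_eq)
  have l: "lead_coeff ?p = 1" using uv by (simp add: lead_coeff_mult lead_coeff_power)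
  have dd: "divided_difference ?M ?p = coeff ?p (?N - ?k)" if "?k \<le> s"
    using that d M(1)[of r] by (simp add: divided_difference_small)
  show "signed_differences ?M u v I ?k s = 0" if "?k < s"
  proof -
    have "degree ?p < ?N - ?k" using d that s deg by simp
    then show ?thesis using dd that by (simp add: signed_differences_def coeff_eq_0)
  qed
  show "signed_differences ?M u v I ?k s = 1" if "?k = s"
    using dd that l d by (simp add: signed_differences_def flip: power_add mult_2)
qed

lemma degree_X_power: "degree ([:0, 1:] ^ k :: 'k::field poly) = k"
  and coeff_X_power: "coeff ([:0, 1:] ^ k :: 'k::field poly) k = 1"
proof -
  have "[:0, 1:] ^ k = (monom 1 k :: 'k poly)" by (simp add: monom_altdef)
  then show "degree ([:0, 1:] ^ k :: 'k poly) = k" "coeff ([:0, 1:] ^ k :: 'k poly) k = 1"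
    by (simp_all add: degree_monom_eq)
qed

lemma column_poly_degree_le:
  assumes "odd m" "m \<le> n"
  shows "column_poly n r m \<in> degree_le n (card (odds m))"
proof -
  have N: "n mod 2 + card (evens n) = card (odds n)"
    unfolding card_odds card_evens by presburger
  show ?thesis
    unfolding column_poly_def
    by (intro degree_le_diff subset_poly_degree_le signed_differences_column(1)[OF assms])
      (use N in \<open>simp_all add: coeff_X_power degree_X_power\<close>, auto simp: odds_def evens_def)
qed

lemma lookup_column_poly:
  assumes "odd m" "m \<le> n"
  shows "Poly_Mapping.lookup (column_poly n r m) (squarefree_monomial (odds m)) = 1"
proof -
  have "odds m \<subseteq> odds n" using assms by (auto simp: odds_def)
  moreover have "1 \<in> odds m" "1 \<notin> evens n" using assms one_mem_odds[of m m] by (auto simp: evens_def)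
  ultimately show ?thesis
    unfolding column_poly_def lookup_minus
    using signed_differences_column(2)[OF assms, of 1 "[:0, 1:]" "odds n" "card (odds m)" r]
      degree_column_modulus(2)[OF assms]
    by (auto simp: lookup_subset_poly)
qed

lemma keys_column_poly:
  assumes "e \<in> Poly_Mapping.keys (column_poly n r m)"
  obtains S where "finite S" "e = squarefree_monomial S"
proof -
  let ?c = "\<lambda>u v I. signed_differences (column_modulus n r m) u v I (card (odds m))"
  have "e \<in> Poly_Mapping.keys (subset_poly (?c 1 [:0, 1:] (odds n)) (odds n)) \<union>
      Poly_Mapping.keys (subset_poly (?c ([:0, 1:] ^ (n mod 2)) [:- r, 1:] (evens n)) (evens n))"
    using assms by (auto simp: column_poly_def in_keys_iff lookup_minus)
  then show thesis
  proof
    assume e: "e \<in> Poly_Mapping.keys (subset_poly (?c 1 [:0, 1:] (odds n)) (odds n))"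
    show thesis
    proof (rule keys_subset_poly[OF finite_odds e])
      fix S
      assume "S \<subseteq> odds n" and S: "e = squarefree_monomial S"
      then have "finite S" using finite_odds by (metis finite_subset)
      then show thesis using S by (rule that)
    qed
  next
    assume e: "e \<in> Poly_Mapping.keys (subset_poly (?c ([:0, 1:] ^ (n mod 2)) [:- r, 1:] (evens n)) (evens n))"
    show thesis
    proof (rule keys_subset_poly[OF finite_evens e])
      fix S
      assume "S \<subseteq> evens n" and S: "e = squarefree_monomial S"
      then have "finite S" using finite_evens by (metis finite_subset)
      then show thesis using S by (rule that)
    qed
  qed
qed

lemma W_image:
  assumes "\<pi> \<in> W n"
  shows "bij_betw \<pi> (odds n) (odds n)" "bij_betw \<pi> (evens n) (evens n)"
proof -
  have p: "\<pi> permutes {1..n}" and m: "\<And>i. i \<in> {1..n} \<Longrightarrow> \<pi> i mod 2 = i mod 2"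
    using assms by (auto simp: W_def)
  have par: "even (\<pi> i) = even i" if "i \<in> {1..n}" for i
    using m[OF that] by (simp add: even_iff_mod_2_eq_zero)
  have "\<pi> ` odds n \<subseteq> odds n" "\<pi> ` evens n \<subseteq> evens n"
    using par permutes_in_image[OF p] unfolding odds_def evens_def by blast+
  moreover have "inj_on \<pi> A" for A using permutes_inj[OF p] by (rule inj_on_subset) simp
  ultimately show "bij_betw \<pi> (odds n) (odds n)" "bij_betw \<pi> (evens n) (evens n)"
    by (simp_all add: bij_betw_def endo_inj_surj)
qed

lemma eval_column_poly_permute:
  assumes "\<pi> \<in> W n"
  shows "eval_poly (z \<circ> \<pi>) (column_poly n r m) = eval_poly z (column_poly n r m)"
proof -
  have "odd_part n (z \<circ> \<pi>) = odd_part n z" "even_part n r (z \<circ> \<pi>) = even_part n r z"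
    using prod.reindex_bij_betw[OF W_image(1)[OF assms], of "\<lambda>i. [:- z i, 1:]"]
      prod.reindex_bij_betw[OF W_image(2)[OF assms], of "\<lambda>i. [:- (z i + r), 1:]"]
    by (simp_all add: odd_part_def even_part_def)
  then show ?thesis by (simp add: eval_column_poly)
qed

lemma odds_less: "{i \<in> odds n. i < n} = (if odd n then odds n - {n} else odds n)"
  by (auto simp: odds_def le_less)

lemma prod_evens: "(\<Prod>i \<in> evens n. h i) = (\<Prod>i \<in> {i \<in> odds n. i < n}. h (Suc i))"
  by (rule prod.reindex_bij_witness[where i = Suc and j = "\<lambda>i. i - 1"])
    (auto simp: odds_def evens_def elim!: evenE)

lemma sum_evens: "(\<Sum>i \<in> evens n. h i) = (\<Sum>i \<in> {i \<in> odds n. i < n}. h (Suc i))"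
  by (rule sum.reindex_bij_witness[where i = Suc and j = "\<lambda>i. i - 1"])
    (auto simp: odds_def evens_def elim!: evenE)

text \<open>
  Both parts become products over the odd indices, which makes them comparable factor by factor.
\<close>
lemma even_part_alt:
  "even_part n r z = (\<Prod>i \<in> odds n. [:- (if i < n then z (Suc i) + r else 0), 1:])"
proof -
  let ?h = "\<lambda>i. [:- (if i < n then z (Suc i) + r else 0), 1:]"
  have "(\<Prod>i \<in> odds n. ?h i) = [:0, 1:] ^ (n mod 2) * (\<Prod>i \<in> {i \<in> odds n. i < n}. ?h i)"
  proof (cases "odd n")
    case True
    then have "n \<in> odds n" by (auto simp: odds_def odd_pos Suc_leI)
    then show ?thesis using True
      by (simp add: odds_less prod.remove odd_iff_mod_2_eq_one)
  qed (simp add: odds_less)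
  also have "(\<Prod>i \<in> {i \<in> odds n. i < n}. ?h i) = (\<Prod>i \<in> {i \<in> odds n. i < n}. [:- (z (Suc i) + r), 1:])"
    by (rule prod.cong) auto
  finally show ?thesis by (simp add: even_part_def prod_evens)
qed

lemma column_modulus_dvd:
  assumes "\<And>i. i \<in> odds n \<Longrightarrow> m \<le> i \<Longrightarrow> y i = \<rho> n r i"
  shows "column_modulus n r m dvd (\<Prod>i \<in> odds n. [:- y i, 1:])"
proof -
  have "column_modulus n r m = (\<Prod>i \<in> {i \<in> odds n. m \<le> i}. [:- y i, 1:])"
    unfolding column_modulus_def by (rule prod.cong) (use assms in auto)
  then show ?thesis by (auto intro!: prod_dvd_prod_subset)
qed

section \<open>Values of the column polynomials\<close>

lemma \<Lambda>_antimono: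
  assumes "\<mu> \<in> \<Lambda> n" "1 \<le> i" "i \<le> j"
  shows "\<mu> j \<le> \<mu> i"
proof -
  have descent: "\<mu> (Suc k) \<le> \<mu> k" if "1 \<le> k" for k
    using assms(1) that by (cases "k < n") (auto simp: \<Lambda>_def)
  show ?thesis
    using assms(3)
  proof (induction rule: dec_induct)
    case (step k)
    then show ?case using assms(2) descent[of k] by simp
  qed simp
qed

definition shifted_point :: "nat \<Rightarrow> 'k::field_char_0 \<Rightarrow> (nat \<Rightarrow> nat) \<Rightarrow> nat \<Rightarrow> 'k" where
  "shifted_point n r \<mu> i = \<rho> n r i + of_nat (\<mu> i)"

definition even_size :: "nat \<Rightarrow> (nat \<Rightarrow> nat) \<Rightarrow> nat" where
  "even_size n \<mu> = (\<Sum>i \<in> evens n. \<mu> i)"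

lemma odd_size_odds: "odd_size n \<mu> = (\<Sum>i \<in> odds n. \<mu> i)"
  by (simp add: odd_size_def odds_def)

lemma even_part_shifted_point:
  assumes "\<mu> \<in> \<Lambda> n"
  shows "even_part n r (shifted_point n r \<mu>) = (\<Prod>i \<in> odds n. [:- (\<rho> n r i + of_nat (\<mu> (Suc i))), 1:])"
  unfolding even_part_alt
proof (rule prod.cong)
  fix i assume i: "i \<in> odds n"
  show "[:- (if i < n then shifted_point n r \<mu> (Suc i) + r else 0), 1:]
      = [:- (\<rho> n r i + of_nat (\<mu> (Suc i))), 1:]"
  proof (cases "i < n")
    case True
    then have "\<rho> n r (Suc i) + r = \<rho> n r i"
      by (simp add: \<rho>_def of_nat_diff algebra_simps)
    then have "shifted_point n r \<mu> (Suc i) + r = \<rho> n r i + of_nat (\<mu> (Suc i))"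
      by (metis add.assoc add.commute shifted_point_def)
    then show ?thesis using True by (simp only: if_True)
  next
    case False
    then show ?thesis using i assms by (auto simp: odds_def \<rho>_def \<Lambda>_def)
  qed
qed simp

text \<open>
  The excess of the odd over the even entries is a sum of descents, so it vanishes only if every odd
  entry equals its even successor.
\<close>
lemma odd_size_eq:
  assumes "\<mu> \<in> \<Lambda> n"
  shows "odd_size n \<mu> = even_size n \<mu> + (\<Sum>i \<in> odds n. \<mu> i - \<mu> (Suc i))"
proof -
  have "odd_size n \<mu> = (\<Sum>i \<in> odds n. \<mu> (Suc i) + (\<mu> i - \<mu> (Suc i)))"
    unfolding odd_size_odds
    by (rule sum.cong) (use \<Lambda>_antimono[OF assms] in \<open>auto simp: odds_def\<close>)
  also have "\<dots> = (\<Sum>i \<in> odds n. \<mu> (Suc i)) + (\<Sum>i \<in> odds n. \<mu> i - \<mu> (Suc i))"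
    by (rule sum.distrib)
  also have "(\<Sum>i \<in> odds n. \<mu> (Suc i)) = (\<Sum>i \<in> {i \<in> odds n. i < n}. \<mu> (Suc i))"
  proof (rule sum.mono_neutral_right)
    show "\<forall>i \<in> odds n - {i \<in> odds n. i < n}. \<mu> (Suc i) = 0"
    proof
      fix i assume "i \<in> odds n - {i \<in> odds n. i < n}"
      then have "Suc i \<notin> {1..n}" by (auto simp: odds_def)
      then show "\<mu> (Suc i) = 0" using assms unfolding \<Lambda>_def by blast
    qed
  qed auto
  finally show ?thesis by (simp add: even_size_def sum_evens)
qed

text \<open>
  If \<open>\<mu>\<^sub>m = 0\<close>, both parts contain all factors of the modulus. If the odd
  and the even entries have equal sums, the two parts coincide.
\<close>
lemma column_poly_vanishing:
  assumes "\<mu> \<in> \<Lambda> n" "m \<ge> 1" "\<mu> m = 0 \<or> odd_size n \<mu> = even_size n \<mu>"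
  shows "eval_poly (shifted_point n r \<mu>) (column_poly n r m) = 0"
  using assms(3)
proof
  assume 0: "\<mu> m = 0"
  have "\<mu> i = 0" if "m \<le> i" for i using \<Lambda>_antimono[OF assms(1,2) that] 0 by simp
  then have "shifted_point n r \<mu> i = \<rho> n r i" "\<rho> n r i + of_nat (\<mu> (Suc i)) = \<rho> n r i" if "m \<le> i" for i
    using that by (simp_all add: shifted_point_def)
  then have "column_modulus n r m dvd odd_part n (shifted_point n r \<mu>)"
    "column_modulus n r m dvd even_part n r (shifted_point n r \<mu>)"
    unfolding even_part_shifted_point[OF assms(1)] odd_part_def
    by (intro column_modulus_dvd; simp only:)+
  then show ?thesis by (simp add: eval_column_poly divided_difference_dvd)
next
  assume "odd_size n \<mu> = even_size n \<mu>"
  then have "\<mu> i - \<mu> (Suc i) = 0" if "i \<in> odds n" for i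
    using odd_size_eq[OF assms(1)] that by simp
  then have "\<mu> i = \<mu> (Suc i)" if "i \<in> odds n" for i
    using that \<Lambda>_antimono[OF assms(1), of i "Suc i"] by (fastforce simp: odds_def)
  then have "odd_part n (shifted_point n r \<mu>) = even_part n r (shifted_point n r \<mu>)"
    unfolding even_part_shifted_point[OF assms(1)] odd_part_def
    by (intro prod.cong) (simp_all add: shifted_point_def)
  then show ?thesis by (simp add: eval_column_poly)
qed

lemma eval_subset_poly_linear:
  fixes c :: "nat \<Rightarrow> 'k::comm_ring_1"
  assumes "finite I" "\<And>s. s \<le> card I \<Longrightarrow> 1 < s \<Longrightarrow> c s = 0" "1 \<le> card I \<Longrightarrow> c 1 = 1"
  shows "eval_poly z (subset_poly c I) = c 0 + (\<Sum>i \<in> I. z i)"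
proof -
  have "eval_poly z (subset_poly c I)
      = (\<Sum>S \<in> insert {} ((\<lambda>i. {i}) ` I). c (card S) * (\<Prod>i \<in> S. z i))"
    unfolding eval_subset_poly[OF assms(1)]
  proof (rule sum.mono_neutral_right)
    show "\<forall>S \<in> Pow I - insert {} ((\<lambda>i. {i}) ` I). c (card S) * (\<Prod>i \<in> S. z i) = 0"
    proof
      fix S assume S: "S \<in> Pow I - insert {} ((\<lambda>i. {i}) ` I)"
      then have "finite S" "card S \<le> card I" using assms(1) by (auto intro: finite_subset card_mono)
      moreover have "card S \<noteq> 0" "card S \<noteq> 1" using S \<open>finite S\<close> by (auto simp: card_1_singleton_iff)
      then have "1 < card S" by linarith
      ultimately show "c (card S) * (\<Prod>i \<in> S. z i) = 0" using assms(2)[of "card S"] by simp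
    qed
  qed (use assms(1) in auto)
  also have "\<dots> = c 0 + (\<Sum>i \<in> I. c 1 * z i)"
    using assms(1) by (subst sum.insert) (auto simp: sum.reindex)
  also have "(\<Sum>i \<in> I. c 1 * z i) = (\<Sum>i \<in> I. z i)"
  proof (cases "I = {}")
    case False
    then have "1 \<le> card I" using assms(1) by (simp add: Suc_leI card_gt_0_iff)
    then show ?thesis using assms(3) by simp
  qed simp
  finally show ?thesis .
qed

lemma odds_1 [simp]: "odds 1 = {1}" "odds (Suc 0) = {1}"
  by (auto simp: odds_def)

text \<open>
  The polynomial of the column of length 1 is a constant plus the odd minus the even variables.
  The constant need not be computed: it is fixed by the zero at \<open>\<rho>\<close>.
\<close>
lemma eval_column_poly_1:
  assumes "1 \<le> n" "\<mu> \<in> \<Lambda> n"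
  shows "eval_poly (shifted_point n r \<mu>) (column_poly n r 1) = of_nat (odd_size n \<mu>) - of_nat (even_size n \<mu>)"
proof -
  have N: "n mod 2 + card (evens n) = card (odds n)"
    unfolding card_odds card_evens by presburger
  let ?s = "\<lambda>u v I. signed_differences (column_modulus n r 1) u v I (card (odds 1))"
  have linear: "eval_poly z (subset_poly (?s u v I) I) = ?s u v I 0 + (\<Sum>i \<in> I. z i)"
    if "finite I" "lead_coeff u = 1" "lead_coeff v = 1" "degree v = 1" "degree u + card I = card (odds n)"
    for u v I z
    using that assms(1)
    by (intro eval_subset_poly_linear signed_differences_column) simp_all
  have "\<exists>c. \<forall>z. eval_poly z (column_poly n r 1) = c + (\<Sum>i \<in> odds n. z i) - (\<Sum>i \<in> evens n. z i)"
  proof (intro exI allI)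
    fix z
    show "eval_poly z (column_poly n r 1) = (?s 1 [:0, 1:] (odds n) 0
          - ?s ([:0, 1:] ^ (n mod 2)) [:- r, 1:] (evens n) 0)
        + (\<Sum>i \<in> odds n. z i) - (\<Sum>i \<in> evens n. z i)"
      unfolding column_poly_def eval_poly_diff
      using N by (subst (1 2) linear) (simp_all add: coeff_X_power degree_X_power)
  qed
  then obtain c where c: "eval_poly z (column_poly n r 1) = c + (\<Sum>i \<in> odds n. z i) - (\<Sum>i \<in> evens n. z i)" for z
    by blast
  have "(\<lambda>_. 0) \<in> \<Lambda> n" by (simp add: \<Lambda>_def)
  then have "eval_poly (shifted_point n r (\<lambda>_. 0)) (column_poly n r 1) = 0"
    by (rule column_poly_vanishing) simp_all
  then show ?thesis
    unfolding c by (simp add: shifted_point_def sum.distrib odd_size_odds even_size_def algebra_simps)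
qed

section \<open>Hooks\<close>

lemma bracket_step: "j \<le> n \<Longrightarrow> bracket n l j = int (l j) - bracket n l (Suc j)"
proof -
  assume "j \<le> n"
  then have "bracket n l j = int (l j) + (\<Sum>i = Suc j..n. (- 1) ^ (i - j) * int (l i))"
    by (simp add: bracket_def sum.atLeast_Suc_atMost)
  also have "(\<Sum>i = Suc j..n. (- 1) ^ (i - j) * int (l i))
      = (\<Sum>i = Suc j..n. - ((- 1) ^ (i - Suc j) * int (l i)))"
    by (rule sum.cong) (auto simp: Suc_diff_Suc[symmetric] simp del: diff_Suc_Suc)
  finally show ?thesis by (simp add: bracket_def sum_negf)
qed

lemma bracket_hook:
  assumes "odd m" "m \<le> n" "1 < j" "j \<le> Suc n"
  shows "bracket n (hook a m) j = (if j \<in> odds m then 1 else 0)"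
  using assms(4,3)
proof (induction rule: inc_induct)
  case base
  show ?case using assms(2) by (simp add: bracket_def odds_def)
next
  case (step j)
  have "bracket n (hook a m) j = (if j \<le> m then 1 else 0) - (if Suc j \<in> odds m then 1 else 0)"
    using step bracket_step[of j n "hook a m"] by (simp add: hook_def)
  moreover have "Suc j \<in> odds m \<longleftrightarrow> even j \<and> j \<le> m"
    using assms(1) by (cases "j = m") (auto simp: odds_def)
  moreover have "j \<in> odds m \<longleftrightarrow> odd j \<and> j \<le> m"
    using step.prems by (auto simp: odds_def)
  ultimately show ?case by simp
qed

lemma bracket_monomial_hook:
  assumes "odd m" "m \<le> n" "1 \<le> a"
  shows "bracket_monomial n (hook a m) = Poly_Mapping.single 1 (a - 1) + squarefree_monomial (odds m)"
proof (rule poly_mapping_eqI)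
  fix i
  have m: "1 \<le> m" "1 \<in> odds m" using assms(1) by (auto simp: odds_def odd_pos Suc_leI)
  have "bracket n (hook a m) 1 = int a"
    using bracket_step[of 1 n "hook a m"] bracket_hook[OF assms(1,2), of "Suc 1" a] m assms(2)
    by (simp add: hook_def odds_def)
  moreover have "Poly_Mapping.lookup (bracket_monomial n (hook a m)) i
      = (if i \<in> {1..n} then nat (bracket n (hook a m) i) else 0)"
    by (simp add: bracket_monomial_def lookup_sum lookup_single when_def)
  ultimately show "Poly_Mapping.lookup (bracket_monomial n (hook a m)) i
      = Poly_Mapping.lookup (Poly_Mapping.single 1 (a - 1) + squarefree_monomial (odds m)) i"
    using bracket_hook[OF assms(1,2), of i a] m assms(2,3)
    by (cases "i = 1") (auto simp: lookup_add lookup_single when_def lookup_squarefree_monomial odds_def)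
qed

lemma odd_size_hook:
  assumes "odd m" "m \<le> n" "1 \<le> a"
  shows "odd_size n (hook a m) = a - 1 + card (odds m)"
proof -
  have m: "1 \<in> odds m" "1 \<in> odds n" using assms one_mem_odds by auto
  have "odd_size n (hook a m) = a + (\<Sum>i \<in> odds n - {1}. hook a m i)"
    unfolding odd_size_odds using m by (simp add: sum.remove hook_def)
  also have "(\<Sum>i \<in> odds n - {1}. hook a m i) = (\<Sum>i \<in> odds m - {1}. 1)"
    by (rule sum.mono_neutral_cong_right) (use assms in \<open>auto simp: odds_def hook_def\<close>)
  also have "\<dots> = card (odds m) - 1" using m by simp
  also have "a + (card (odds m) - 1) = a - 1 + card (odds m)"
    using assms(3) m(1) card_gt_0_iff[of "odds m"] by auto
  finally show ?thesis .
qed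

text \<open>
  Since \<open>\<mu>\<^sub>m \<ge> 1\<close>, the even entries sum to at least \<open>card (odds m) - 1\<close>. The two size bounds leave no
  room: the even entries are 1 up to \<open>m\<close> and 0 after it, by monotonicity the odd ones from the third
  on follow, and the first entry is what remains.
\<close>
lemma hook_characterization:
  assumes \<mu>: "\<mu> \<in> \<Lambda> n" and m: "odd m" "m \<le> n" "1 \<le> \<mu> m" and a: "1 \<le> a"
    and size: "odd_size n \<mu> \<le> a - 1 + card (odds m)" and large: "even_size n \<mu> + a \<le> odd_size n \<mu>"
  shows "\<mu> = hook a m"
proof -
  have m1: "1 \<in> odds m" "1 \<in> odds n" using m one_mem_odds by auto
  let ?h = "\<lambda>i. if i \<le> m then 1 else 0 :: nat"
  have ge: "?h i \<le> \<mu> i" if "1 \<le> i" for i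
    using \<Lambda>_antimono[OF \<mu> that, of m] m(3) by auto
  have "card (odds m) = Suc (card (evens m))"
    using m(1) unfolding card_odds card_evens by presburger
  then have "even_size n \<mu> \<le> card (evens m)" using size large a by simp
  moreover have "card (evens m) = (\<Sum>i \<in> evens n. ?h i)"
  proof -
    have "{i \<in> evens n. i \<le> m} = evens m" using m(2) by (auto simp: evens_def)
    then show ?thesis by (simp add: sum.If_cases Int_def)
  qed
  moreover have "(\<Sum>i \<in> evens n. \<mu> i) = (\<Sum>i \<in> evens n. ?h i) + (\<Sum>i \<in> evens n. \<mu> i - ?h i)"
    unfolding sum.distrib[symmetric]
  proof (rule sum.cong[OF refl])
    fix i assume "i \<in> evens n"
    then show "\<mu> i = ?h i + (\<mu> i - ?h i)" using ge[of i] by (auto simp: evens_def)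
  qed
  ultimately have "(\<Sum>i \<in> evens n. \<mu> i - ?h i) = 0" by (simp add: even_size_def)
  then have le: "\<mu> i \<le> ?h i" if "i \<in> evens n" for i using that by (simp split: if_splits)
  have even: "\<mu> i = ?h i" if "i \<in> evens n" for i
    by (rule antisym[OF le[OF that] ge]) (use that in \<open>simp add: evens_def\<close>)
  have rest: "\<mu> i = hook a m i" if "i \<noteq> 1" for i
  proof (cases "i \<in> {1..n}")
    case False
    then show ?thesis using \<mu> m that by (auto simp: \<Lambda>_def hook_def)
  next
    case True
    have "\<mu> i = ?h i"
    proof (cases "even i")
      case True
      then show ?thesis using even \<open>i \<in> {1..n}\<close> by (simp add: evens_def)
    next
      case False
      then have i: "i - 1 \<in> evens n" "1 \<le> i - 1" "i - 1 \<le> i"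
        using that True by (auto simp: evens_def elim!: oddE)
      have "i - 1 \<le> m \<longleftrightarrow> i \<le> m" using False m(1) i(2) by presburger
      then have "\<mu> i \<le> ?h i" using \<Lambda>_antimono[OF \<mu> i(2,3)] even[OF i(1)] by simp
      then show ?thesis by (rule antisym[OF _ ge]) (use True in simp)
    qed
    then show ?thesis using that True by (simp add: hook_def)
  qed
  have "odd_size n \<mu> = odd_size n (hook a m)"
  proof -
    have "card (evens m) \<le> even_size n \<mu>"
      unfolding even_size_def \<open>card (evens m) = (\<Sum>i \<in> evens n. ?h i)\<close>
      by (rule sum_mono) (simp only: even order_refl)
    then show ?thesis
      using size large a \<open>card (odds m) = Suc (card (evens m))\<close> odd_size_hook[OF m(1,2) a] by simp
  qed
  moreover have "(\<Sum>i \<in> odds n - {1}. \<mu> i) = (\<Sum>i \<in> odds n - {1}. hook a m i)"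
    by (rule sum.cong) (use rest in auto)
  ultimately have "\<mu> 1 = hook a m 1"
    unfolding odd_size_odds using m1 by (simp add: sum.remove)
  then show ?thesis using rest by (metis ext)
qed

text \<open>
  If \<open>e0\<close> is the only monomial of \<open>f\<close> with its exponent of \<open>x\<close> or a higher one, and no monomial of \<open>g\<close>
  exceeds \<open>e1\<close> in \<open>x\<close>, there is only one way to obtain \<open>e0 + e1\<close>.
\<close>
lemma lookup_mult_leading:
  fixes f g :: "'k::comm_ring_1 polynomial"
  assumes f: "\<And>e. e \<in> Poly_Mapping.keys f \<Longrightarrow> Poly_Mapping.lookup e0 x \<le> Poly_Mapping.lookup e x \<Longrightarrow> e = e0"
    and g: "\<And>e. e \<in> Poly_Mapping.keys g \<Longrightarrow> Poly_Mapping.lookup e x \<le> Poly_Mapping.lookup e1 x"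
  shows "Poly_Mapping.lookup (f * g) (e0 + e1) = Poly_Mapping.lookup f e0 * Poly_Mapping.lookup g e1"
proof -
  let ?F = "Poly_Mapping.keys f" and ?G = "Poly_Mapping.keys g"
  have "f * g = (\<Sum>a \<in> ?F. \<Sum>b \<in> ?G.
      Poly_Mapping.single (a + b) (Poly_Mapping.lookup f a * Poly_Mapping.lookup g b))"
    by (rule mult_eq_sum_singles)
  then have "Poly_Mapping.lookup (f * g) (e0 + e1) = (\<Sum>a \<in> ?F. \<Sum>b \<in> ?G.
      if a + b = e0 + e1 then Poly_Mapping.lookup f a * Poly_Mapping.lookup g b else 0)"
    by (simp add: lookup_sum lookup_single when_def)
  also have "\<dots> = (\<Sum>a \<in> ?F. \<Sum>b \<in> ?G.
      if a = e0 then if b = e1 then Poly_Mapping.lookup f a * Poly_Mapping.lookup g b else 0 else 0)"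
  proof (intro sum.cong refl)
    fix a b assume ab: "a \<in> ?F" "b \<in> ?G"
    have "a = e0 \<and> b = e1" if eq: "a + b = e0 + e1"
    proof -
      have "Poly_Mapping.lookup a x + Poly_Mapping.lookup b x = Poly_Mapping.lookup e0 x + Poly_Mapping.lookup e1 x"
        using arg_cong[OF eq, of "\<lambda>e. Poly_Mapping.lookup e x"] by (simp add: lookup_add)
      then have "a = e0" using f[OF ab(1)] g[OF ab(2)] by simp
      then show ?thesis using eq by simp
    qed
    then show "(if a + b = e0 + e1 then Poly_Mapping.lookup f a * Poly_Mapping.lookup g b else 0)
      = (if a = e0 then if b = e1 then Poly_Mapping.lookup f a * Poly_Mapping.lookup g b else 0 else 0)"
      by auto
  qed
  also have "\<dots> = Poly_Mapping.lookup f e0 * Poly_Mapping.lookup g e1"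
  proof -
    have "(\<Sum>b \<in> ?G. if a = e0 then if b = e1 then Poly_Mapping.lookup f a * Poly_Mapping.lookup g b else 0 else 0)
        = (if a = e0 then Poly_Mapping.lookup f e0 * Poly_Mapping.lookup g e1 else 0)" for a
      by (simp add: in_keys_iff)
    then show ?thesis by (simp add: in_keys_iff)
  qed
  finally show ?thesis .
qed

definition hook_poly :: "nat \<Rightarrow> 'k::field_char_0 \<Rightarrow> nat \<Rightarrow> nat \<Rightarrow> 'k polynomial" where
  "hook_poly n r a m = (\<Prod>j = 1..<a. column_poly n r 1 - of_nat j) * column_poly n r m"

lemma hook_poly_Suc:
  "1 \<le> a \<Longrightarrow> hook_poly n r (Suc a) m = (column_poly n r 1 - of_nat a) * hook_poly n r a m"
  by (simp add: hook_poly_def mult_ac)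

lemma hook_poly_degree_le:
  assumes "odd m" "m \<le> n" "1 \<le> a"
  shows "hook_poly n r a m \<in> degree_le n (a - 1 + card (odds m))"
  using assms(3)
proof (induction rule: dec_induct)
  case base
  show ?case using column_poly_degree_le[OF assms(1,2)] by (simp add: hook_poly_def)
next
  case (step a)
  have "1 \<le> n" using assms by (intro odd_imp_one_le)
  then have "column_poly n r 1 - of_nat a \<in> degree_le n 1"
    using column_poly_degree_le[of 1 n r] by (intro degree_le_diff degree_le_of_nat) simp_all
  from degree_le_mult[OF this step.IH] show ?case
    using step.hyps by (simp add: hook_poly_Suc)
qed

text \<open>
  The coefficient of the distinguished monomial, followed through the product one factor at a time.
  Every factor \<open>column_poly n r 1 - of_nat a\<close> is \<open>z\<^sub>1\<close> plus terms without \<open>z\<^sub>1\<close>, and the bound on the exponent of \<open>z\<^sub>1\<close> excludes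
  all contributions but that of \<open>z\<^sub>1\<close>.
\<close>
lemma hook_poly_leading:
  fixes r :: "'k::field_char_0"
  assumes "odd m" "m \<le> n" "1 \<le> a"
  shows "(\<forall>e \<in> Poly_Mapping.keys (hook_poly n r a m). Poly_Mapping.lookup e 1 \<le> a) \<and>
    Poly_Mapping.lookup (hook_poly n r a m) (Poly_Mapping.single 1 (a - 1) + squarefree_monomial (odds m)) = 1"
  using assms(3)
proof (induction rule: dec_induct)
  case base
  have "Poly_Mapping.lookup e 1 \<le> 1" if e: "e \<in> Poly_Mapping.keys (column_poly n r m)" for e
  proof (rule keys_column_poly[OF e])
    fix S assume "finite S" "e = squarefree_monomial S"
    then show ?thesis by (simp add: lookup_squarefree_monomial)
  qed
  then show ?case using lookup_column_poly[OF assms(1,2)] by (simp add: hook_poly_def)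
next
  case (step a)
  have n: "1 \<le> n" using assms by (intro odd_imp_one_le)
  let ?L = "column_poly n r 1 - of_nat a" and ?H = "hook_poly n r a m"
  let ?e = "Poly_Mapping.single 1 (a - 1) + squarefree_monomial (odds m)"
  let ?x = "Poly_Mapping.single 1 1 :: monomial"
  have x: "?x = squarefree_monomial (odds 1)" by (simp add: squarefree_monomial_def)
  have m1: "1 \<in> odds m" using assms one_mem_odds by auto
  have L: "Poly_Mapping.lookup e 1 \<le> 1 \<and> (1 \<le> Poly_Mapping.lookup e 1 \<longrightarrow> e = ?x)"
    if e: "e \<in> Poly_Mapping.keys ?L" for e
  proof (cases "e = 0")
    case False
    then have e: "e \<in> Poly_Mapping.keys (column_poly n r 1)"
      using e by (simp add: in_keys_iff lookup_minus lookup_of_nat when_def)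
    obtain S where S: "finite S" "e = squarefree_monomial S" by (rule keys_column_poly[OF e])
    have "card S \<le> 1"
      using column_poly_degree_le[of 1 n r] e n S
      by (auto simp: degree_le_def monomial_degree_squarefree_monomial)
    moreover have "S = {1}" if "1 \<in> S"
      using that calculation S(1) card_le_Suc0_iff_eq[OF S(1)] by auto
    ultimately show ?thesis using S unfolding x odds_1 by (auto simp: lookup_squarefree_monomial)
  qed simp
  have "Poly_Mapping.lookup ?L ?x = 1"
  proof -
    have "?x \<noteq> 0" by (metis lookup_single_eq lookup_zero one_neq_zero)
    moreover have "Poly_Mapping.lookup (column_poly n r 1) ?x = 1"
      unfolding x using n by (intro lookup_column_poly) simp_all
    ultimately show ?thesis by (simp add: lookup_minus lookup_of_nat when_def)
  qed
  moreover have e1: "Poly_Mapping.lookup ?e 1 = a"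
    using m1 step.hyps by (simp add: lookup_add lookup_squarefree_monomial)
  moreover have "Poly_Mapping.lookup (?L * ?H) (?x + ?e) = Poly_Mapping.lookup ?L ?x * Poly_Mapping.lookup ?H ?e"
    by (rule lookup_mult_leading[where x = 1]) (use L step.IH e1 in auto)
  moreover have "?x + ?e = Poly_Mapping.single 1 (Suc a - 1) + squarefree_monomial (odds m)"
    using step.hyps by (simp add: add.assoc[symmetric] single_add[symmetric])
  moreover have "Poly_Mapping.lookup e 1 \<le> Suc a" if e: "e \<in> Poly_Mapping.keys (?L * ?H)" for e
  proof -
    obtain b c where "e = b + c" "b \<in> Poly_Mapping.keys ?L" "c \<in> Poly_Mapping.keys ?H"
      using keys_mult[of ?L ?H] e by fast
    then show ?thesis using L[of b] step.IH by (fastforce simp: lookup_add)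
  qed
  ultimately show ?case using step by (simp add: hook_poly_Suc)
qed

text \<open>
  The zeros: let \<open>j\<close> be the excess of the odd over the even entries of \<open>\<mu>\<close>, which is the value of the
  column polynomial of length 1 at \<open>\<rho> + \<mu>\<close>. If \<open>\<mu>\<^sub>m = 0\<close> or \<open>j = 0\<close>, the last factor vanishes; if
  \<open>1 \<le> j < a\<close>, the factor with index \<open>j\<close> does. Among the tuples of the relevant sizes, only the hook
  itself escapes.
\<close>
lemma is_R_hook_poly:
  fixes r :: "'k::field_char_0"
  assumes "odd m" "m \<le> n" "1 \<le> a"
  shows "is_R n r (hook a m) (hook_poly n r a m)"
proof -
  let ?H = "hook_poly n r a m" and ?e = "bracket_monomial n (hook a m)"
  have m1: "1 \<le> m" "1 \<in> odds m" and n: "1 \<le> n"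
    using assms one_mem_odds[of m m] odd_imp_one_le[of m] by auto
  note size = odd_size_hook[OF assms]
  note deg = hook_poly_degree_le[OF assms, of r]
  have lead: "Poly_Mapping.lookup ?H ?e = 1"
    using hook_poly_leading[OF assms, of r] by (simp only: bracket_monomial_hook[OF assms])
  have "monomial_degree ?e = a - 1 + card (odds m)"
    unfolding bracket_monomial_hook[OF assms] monomial_degree_add
    by (simp add: monomial_degree_squarefree_monomial) (simp add: monomial_degree_def)
  moreover have "monomial_degree ?e \<le> total_degree ?H"
    using lead total_degree_le_iff[of ?H "total_degree ?H"] by (simp add: in_keys_iff)
  moreover have "total_degree ?H \<le> a - 1 + card (odds m)"
    using deg by (simp add: total_degree_le_iff degree_le_def)
  ultimately have "total_degree ?H = odd_size n (hook a m)" using size by simp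
  moreover have "permute_vars \<pi> ?H = ?H" if "\<pi> \<in> W n" for \<pi>
  proof -
    have "\<pi> permutes {1..n}" using that by (simp add: W_def)
    then show ?thesis
      by (simp only: permute_vars_invariant_iff hook_poly_def eval_poly_mult eval_poly_prod eval_poly_diff
          eval_column_poly_permute[OF that] eval_poly_of_nat) simp
  qed
  moreover have "eval_poly (\<lambda>i. \<rho> n r i + of_nat (\<mu> i)) ?H = 0"
    if \<mu>: "\<mu> \<in> \<Lambda> n" "odd_size n \<mu> \<le> odd_size n (hook a m)" "\<mu> \<noteq> hook a m" for \<mu>
  proof -
    let ?z = "shifted_point n r \<mu>"
    have "eval_poly ?z ?H = 0"
    proof (cases "\<mu> m = 0 \<or> odd_size n \<mu> = even_size n \<mu>")
      case True
      then show ?thesis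
        using column_poly_vanishing[OF \<mu>(1) m1(1) True, of r] by (simp add: hook_poly_def eval_poly_mult)
    next
      case False
      define j where "j = odd_size n \<mu> - even_size n \<mu>"
      have le: "even_size n \<mu> \<le> odd_size n \<mu>" using odd_size_eq[OF \<mu>(1)] by simp
      then have "eval_poly ?z (column_poly n r 1 - of_nat j) = 0"
        using eval_column_poly_1[OF n \<mu>(1), of r] by (simp add: eval_poly_diff j_def of_nat_diff)
      moreover have "j \<in> {1..<a}"
      proof -
        have "\<not> even_size n \<mu> + a \<le> odd_size n \<mu>"
          using hook_characterization[OF \<mu>(1) assms(1,2) _ assms(3)] \<mu>(2,3) size False by force
        then show ?thesis using le False by (auto simp: j_def)
      qed
      ultimately have "(\<Prod>j = 1..<a. eval_poly ?z (column_poly n r 1 - of_nat j)) = 0"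
        by (metis finite_atLeastLessThan prod_zero)
      then show ?thesis by (simp only: hook_poly_def eval_poly_mult eval_poly_prod mult_zero_left)
    qed
    then show ?thesis by (simp only: shifted_point_def[abs_def])
  qed
  ultimately show ?thesis
    using deg lead unfolding is_R_def degree_le_def by blast
qed

theorem corollary4p10:
  fixes r :: "'k::field_char_0" and n a m :: nat
  assumes "n \<ge> 1"
    and "\<not> (\<exists>q::rat. q < 0 \<and> r = of_rat q)"
    and "a \<ge> 1" and "m \<ge> 1" and "odd m" and "m \<le> n"
  shows "R n r (hook a m) =
    (\<Prod>j = 1..<a. R n r (column 1) - of_nat j) * R n r (column m)"
proof -
  have R_hook: "R n r (hook b l) = hook_poly n r b l" if "odd l" "l \<le> n" "1 \<le> b" for b l
    using that assms(2) by (intro R_eqI is_R_hook_poly)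
  have R_column: "R n r (column l) = column_poly n r l" if "odd l" "l \<le> n" for l
  proof -
    have "column l = hook 1 l" using that(1) by (auto simp: column_def hook_def odd_pos Suc_leI)
    then show ?thesis using R_hook[OF that] by (simp add: hook_poly_def)
  qed
  show ?thesis
    using assms by (simp add: R_hook R_column hook_poly_def)
qed

end
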